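(* In the decentralized basis pursuit setting of the context, consider $x_{(i)}(k)$ generated from $x_{(i)}(0)=0$ by the iteration $$x_{(i)}(k+1)=\sum_{j=1}^nw_{ij}x_{(j)}(k)-\alpha\Big(A_iy_i(k)-\frac bn\Big),\qquad y_i(k)=\gamma\,\mathrm{Shrink}(A_i^Tx_{(i)}(k)),\qquad i=1,\dots,n,$$ and $\bar x(k):=\frac1n\sum_{i=1}^nx_{(i)}(k)$, $y(k)=[y_1(k);\dots;y_n(k)]$. Let $y^*$ be the unique solution of $$\min_{y\in\mathbb{R}^q}\ \|y\|_1+\frac1{2\gamma}\|y\|^2\quad\text{subject to}\quad Ay=b,$$ and let $\bar x^*(k)=\mathrm{Proj}_{\mathcal{X}^*}(\bar x(k))$ be the projection of $\bar x(k)$ onto the optimal solution set $\mathcal{X}^*$ of the dual problem of minimizing $f$. If the stepsize $\alpha>0$ satisfies $\alpha<\min\{(1+\lambda_n(W))/L_h,\ c_1\}$, then $$\|x_{(i)}(k)-\bar x^*(k)\|\le c_3^k\|\bar x^*(0)\|+\Big(\frac{c_4}{\sqrt{1-c_3^2}}+\frac{\alpha D}{1-\beta}\Big),$$ where $$c_3^2=1-\alpha c_2+\alpha\delta-\alpha^2\delta c_2,\qquad c_4^2=\alpha^3(\alpha+\delta^{-1})\frac{L_h^2D^2}{(1-\beta)^2},$$ with $\delta$ any positive constant. In particular, if we set $\delta=\frac{c_2}{2(1-\alpha c_2)}$ such that $c_3=\sqrt{1-\frac{\alpha c_2}2}\in(0,1)$, then $\frac{c_4}{\sqrt{1-c_3^2}}+\frac{\alpha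 D}{1-\beta}=O\big(\frac{\alpha}{1-\beta}\big)$. On the other hand, the primal solution satisfies $$\|y(k)-y^*\|\le n\gamma\max_i\big(\|A_i\|\,\|x_{(i)}(k)-\bar x^*(k)\|\big).$$
   Context: Setting. $b\in\mathbb{R}^p$; $A=[A_1,\dots,A_n]\in\mathbb{R}^{p\times q}$ with column blocks $A_i\in\mathbb{R}^{p\times q_i}$ held by agent $i$ of a connected network of $n$ agents, $q=\sum_iq_i$; the system $Ay=b$ is consistent; $\gamma>0$. $\mathrm{Shrink}(z)=\max(|z|-1,0)\,\mathrm{sign}(z)$ componentwise, and $\mathrm{Proj}_{[-1,1]}$ is the componentwise projection onto $[-1,1]$. The Lagrange dual, cast as a minimization problem, is to minimize over $x\in\mathbb{R}^p$ $$f(x)=\sum_{i=1}^nf_i(x),\qquad f_i(x)=\frac\gamma2\|A_i^Tx-\mathrm{Proj}_{[-1,1]}(A_i^Tx)\|^2-\frac1nb^Tx,$$ with $\nabla f_i(x)=\gamma A_i\mathrm{Shrink}(A_i^Tx)-b/n$, which is Lipschitz with constant $L_{f_i}=\gamma\|A_i\|^2$. $\mathcal{X}^*$ (assumed non-empty) denotes the set of minimizers of $f$. The mixing matrix $W=[w_{ij}]\in\mathbb{R}^{n\times n}$ is symmetric and doubly stochastic, with eigenvalues $1=\lambda_1(W)\ge\dots\ge\lambda_n(W)\ge-1$ and $\beta:=\max\{|\lambda_2(W)|,|\lambda_n(W)|\}<1$. Since $Ay=b$ is consistent, $f$ is known to be restricted strongly convex with a computable modulus $\nu_f>0$: $\langle\nabla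 f(x)-\nabla f(x^* ),x-x^*\rangle\ge\nu_f\|x-x^*\|^2$ for all $x$, with $x^*=\mathrm{Proj}_{\mathcal{X}^*}(x)$ the Euclidean projection. Constants: $L_h=\max_i\gamma\|A_i\|^2$, $L_{\bar f}=\frac\gamma n\sum_{i=1}^n\|A_i\|^2$, $\nu_{\bar f}=\nu_f/n$, $c_1=\theta/L_{\bar f}$ and $c_2=(1-\theta)\nu_{\bar f}$ for any $\theta\in[0,1]$, $D=\sqrt{2L_h\sum_{i=1}^n(f_i(0)-f_i^o)}$ with $f_i^o=f_i(x_{(i)}^o)$, $x_{(i)}^o=\arg\min_xf_i(x)$. Vector norms are Euclidean and matrix norms are spectral. *)

theory Defs
  imports "HOL-Analysis.Analysis" "HOL-Computational_Algebra.Polynomial" "HOL-Library.Landau_Symbols"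
begin

definition charpoly :: "real^'n^'n \<Rightarrow> real poly" where
  "charpoly M = det (\<chi> i j. (if i = j then [:0, 1:] else 0) - [:M $ i $ j:])"

text \<open>\<open>eigenvalue_list M lam\<close>: the numbers \<open>lam 1 \<ge> \<dots> \<ge> lam n\<close>, \<open>n = CARD('n)\<close>, are the
  eigenvalues of \<open>M\<close> with multiplicity. Values of \<open>lam\<close> outside \<open>{1..n}\<close> are irrelevant.\<close>

definition eigenvalue_list :: "real^'n^'n \<Rightarrow> (nat \<Rightarrow> real) \<Rightarrow> bool" where
  "eigenvalue_list M lam \<longleftrightarrow>
     charpoly M = (\<Prod>k = 1..CARD('n). [:- lam k, 1:]) \<and>
     (\<forall>k l. 1 \<le> k \<and> k \<le> l \<and> l \<le> CARD('n) \<longrightarrow> lam l \<le> lam k)"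

definition doubly_stochastic :: "real^'n^'n \<Rightarrow> bool" where
  "doubly_stochastic W \<longleftrightarrow>
     (\<forall>i j. 0 \<le> W $ i $ j) \<and> (\<forall>i. (\<Sum>j\<in>UNIV. W $ i $ j) = 1) \<and> (\<forall>j. (\<Sum>i\<in>UNIV. W $ i $ j) = 1)"

definition gradient :: "('a::euclidean_space \<Rightarrow> real) \<Rightarrow> 'a \<Rightarrow> 'a" where
  "gradient f x = (THE g. GDERIV f x :> g)"

definition minimizers :: "('a \<Rightarrow> real) \<Rightarrow> 'a set" where
  "minimizers f = {x. is_arg_min f (\<lambda>_. True) x}"

definition restricted_strongly_convex :: "('a::euclidean_space \<Rightarrow> real) \<Rightarrow> real \<Rightarrow> bool" where
  "restricted_strongly_convex f \<nu> \<longleftrightarrow>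
     (\<forall>x. let xs = closest_point (minimizers f) x in
        (gradient f x - gradient f xs) \<bullet> (x - xs) \<ge> \<nu> * (norm (x - xs))\<^sup>2)"

abbreviation spectral_norm :: "real^'q^'p \<Rightarrow> real" where
  "spectral_norm M \<equiv> onorm ((*v) M)"

text \<open>The block structure of \<open>A\<close> is given by \<open>own\<close>, where \<open>own c\<close> is the agent holding column \<open>c\<close>.
  The blocks \<open>A\<^sub>i\<close> have different widths, so \<open>A\<^sub>i\<close> is represented by the \<open>p \<times> q\<close> matrix in which the
  columns of the other agents are replaced by zero. This changes neither the spectral norm of
  \<open>A\<^sub>i\<close> nor the Euclidean norms of vectors in the range of \<open>A\<^sub>i\<^sup>T\<close>, which are padded by zeros;
  \<open>shrink\<close> and \<open>proj_box\<close> preserve zero entries.\<close>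

definition block :: "('q \<Rightarrow> 'n) \<Rightarrow> real^'q^'p \<Rightarrow> 'n \<Rightarrow> real^'q^'p" where
  "block own A i = (\<chi> r c. if own c = i then A $ r $ c else 0)"

definition shrink :: "real^'q \<Rightarrow> real^'q" where
  "shrink z = (\<chi> c. max (\<bar>z $ c\<bar> - 1) 0 * sgn (z $ c))"

definition proj_box :: "real^'q \<Rightarrow> real^'q" where
  "proj_box z = (\<chi> c. closest_point {-1..1} (z $ c))"

definition local_obj ::
  "real \<Rightarrow> ('q \<Rightarrow> 'n::finite) \<Rightarrow> real^'q^'p \<Rightarrow> real^'p \<Rightarrow> 'n \<Rightarrow> real^'p \<Rightarrow> real" where
  "local_obj \<gamma> own A b i x =
     (let z = transpose (block own A i) *v x
      in \<gamma> / 2 * (norm (z - proj_box z))\<^sup>2 - 1 / real CARD('n) * (b \<bullet> x))"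

definition dual_obj ::
  "real \<Rightarrow> ('q \<Rightarrow> 'n::finite) \<Rightarrow> real^'q^'p \<Rightarrow> real^'p \<Rightarrow> real^'p \<Rightarrow> real" where
  "dual_obj \<gamma> own A b x = (\<Sum>i\<in>UNIV. local_obj \<gamma> own A b i x)"

definition primal_obj :: "real \<Rightarrow> real^'q \<Rightarrow> real" where
  "primal_obj \<gamma> y = (\<Sum>c\<in>UNIV. \<bar>y $ c\<bar>) + 1 / (2 * \<gamma>) * (norm y)\<^sup>2"

definition primal_solution :: "real \<Rightarrow> real^'q^'p \<Rightarrow> real^'p \<Rightarrow> real^'q \<Rightarrow> bool" where
  "primal_solution \<gamma> A b y \<longleftrightarrow> is_arg_min (primal_obj \<gamma>) (\<lambda>y. A *v y = b) y"

definition local_primal ::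
  "real \<Rightarrow> ('q \<Rightarrow> 'n) \<Rightarrow> real^'q^'p \<Rightarrow> (nat \<Rightarrow> 'n \<Rightarrow> real^'p) \<Rightarrow> nat \<Rightarrow> 'n \<Rightarrow> real^'q" where
  "local_primal \<gamma> own A x k i = \<gamma> *\<^sub>R shrink (transpose (block own A i) *v x k i)"

definition stacked_primal ::
  "real \<Rightarrow> ('q \<Rightarrow> 'n) \<Rightarrow> real^'q^'p \<Rightarrow> (nat \<Rightarrow> 'n \<Rightarrow> real^'p) \<Rightarrow> nat \<Rightarrow> real^'q" where
  "stacked_primal \<gamma> own A x k = (\<chi> c. local_primal \<gamma> own A x k (own c) $ c)"

definition average :: "('n::finite \<Rightarrow> real^'p) \<Rightarrow> real^'p" where
  "average v = (1 / real CARD('n)) *\<^sub>R (\<Sum>i\<in>UNIV. v i)"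

definition D_const ::
  "real \<Rightarrow> ('q \<Rightarrow> 'n::finite) \<Rightarrow> real^'q^'p \<Rightarrow> real^'p \<Rightarrow> real \<Rightarrow> real" where
  "D_const \<gamma> own A b Lh =
     sqrt (2 * Lh * (\<Sum>i\<in>UNIV. local_obj \<gamma> own A b i 0 -
        local_obj \<gamma> own A b i (arg_min (local_obj \<gamma> own A b i) (\<lambda>_. True))))"

definition c3 :: "real \<Rightarrow> real \<Rightarrow> real \<Rightarrow> real" where
  "c3 c2 \<alpha> \<delta> = sqrt (1 - \<alpha> * c2 + \<alpha> * \<delta> - \<alpha>\<^sup>2 * \<delta> * c2)"

definition c4 :: "real \<Rightarrow> real \<Rightarrow> real \<Rightarrow> real \<Rightarrow> real \<Rightarrow> real" where
  "c4 Lh D \<beta> \<alpha> \<delta> = sqrt (\<alpha> ^ 3 * (\<alpha> + inverse \<delta>) * (Lh\<^sup>2 * D\<^sup>2 / (1 - \<beta>)\<^sup>2))"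

definition error_floor :: "real \<Rightarrow> real \<Rightarrow> real \<Rightarrow> real \<Rightarrow> real \<Rightarrow> real \<Rightarrow> real" where
  "error_floor Lh D c2 \<beta> \<alpha> \<delta> =
     c4 Lh D \<beta> \<alpha> \<delta> / sqrt (1 - (c3 c2 \<alpha> \<delta>)\<^sup>2) + \<alpha> * D / (1 - \<beta>)"

definition delta_opt :: "real \<Rightarrow> real \<Rightarrow> real" where
  "delta_opt c2 \<alpha> = c2 / (2 * (1 - \<alpha> * c2))"

end

theory Submission
  imports Defs
begin

text \<open>Everything rests on two elementary facts: \<open>shrink\<close> is the gradient of half the squared distance
  to the unit box and is firmly nonexpansive, and \<open>W\<close> contracts the orthogonal complement of the
  constants by the factor \<open>\<beta>\<close>.

  The iteration is gradient descent with unit stepsize for a function that dominates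
  \<open>\<alpha> \<Sum>\<^sub>i f\<^sub>i\<close> and agrees with it at 0; since \<open>\<alpha> \<le> (1 + \<lambda>\<^sub>n) / L\<^sub>h\<close> this function decreases, so the stacked
  gradients stay bounded by \<open>D\<close>. The deviation from the average is multiplied by at most \<open>\<beta>\<close> and
  increased by at most \<open>\<alpha> D\<close> in each step, hence stays below \<open>\<alpha> D / (1 - \<beta>)\<close>. The average therefore performs
  an inexact gradient step with error at most \<open>L\<^sub>h \<alpha> D / (1 - \<beta>)\<close>, and restricted strong convexity together
  with cocoercivity makes the exact step contract the distance to the minimizers.

  On the primal side, \<open>\<gamma> shrink (A\<^sup>T x\<^sup>*)\<close> is feasible for a dual minimizer \<open>x\<^sup>*\<close> because the dual gradient vanishes,
  and it is the unique optimum because \<open>A\<^sup>T x\<^sup>*\<close> is a subgradient there of the strongly convex primal objective.\<close>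

section \<open>Shrinkage and the local objectives\<close>

lemma closest_point_unit_interval: "closest_point {-1..1} (t::real) = max (-1) (min 1 t)"
  by (rule closest_point_unique[symmetric]) (auto simp: dist_real_def)

lemma shrink_nth: "shrink z $ c = z $ c - max (-1) (min 1 (z $ c))"
  by (auto simp: shrink_def sgn_if max_def min_def abs_if)

lemma shrink_eq_diff_proj_box: "shrink z = z - proj_box z"
  by (simp add: vec_eq_iff shrink_nth proj_box_def closest_point_unit_interval)

lemma clip_variational:
  fixes t q :: real
  assumes "\<bar>q\<bar> \<le> 1"
  shows "0 \<le> (t - max (-1) (min 1 t)) * (max (-1) (min 1 t) - q)"
  using assms by (auto simp: max_def min_def mult_nonneg_nonneg mult_nonpos_nonpos abs_le_iff)

lemma clip_abs_le_1: "\<bar>max (-1) (min 1 (t::real))\<bar> \<le> 1"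
  by auto

text \<open>The obtuse-angle property of the projection onto the unit box, with
  \<open>shrink z\<close> as residual; the box is a product, so it holds coordinate by
  coordinate.\<close>

lemma shrink_variational:
  fixes z :: "real^'q"
  assumes "\<And>c. \<bar>w $ c\<bar> \<le> 1"
  shows "0 \<le> shrink z \<bullet> (proj_box z - w)"
  unfolding inner_vec_def
  by (rule sum_nonneg)
     (simp add: shrink_nth proj_box_def closest_point_unit_interval clip_variational assms)

lemma abs_proj_box_le_1: "\<bar>proj_box z $ c\<bar> \<le> 1"
  by (simp only: proj_box_def vec_lambda_beta closest_point_unit_interval clip_abs_le_1)

text \<open>Add the variational inequalities at \<open>u\<close> and at \<open>v\<close>, each
  tested with the projection of the other point.\<close>

lemma shrink_firmly_nonexpansive:
  fixes u v :: "real^'q"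
  shows "(norm (shrink u - shrink v))\<^sup>2 \<le> (shrink u - shrink v) \<bullet> (u - v)"
proof -
  have "0 \<le> shrink u \<bullet> (proj_box u - proj_box v)" "0 \<le> shrink v \<bullet> (proj_box v - proj_box u)"
    by (rule shrink_variational, rule abs_proj_box_le_1)+
  then show ?thesis
    by (simp add: power2_norm_eq_inner shrink_eq_diff_proj_box algebra_simps inner_commute)
qed

lemma norm_shrink_diff_le: "norm (shrink u - shrink v) \<le> norm (u - v)"
proof -
  have "norm (shrink u - shrink v) * norm (shrink u - shrink v) \<le> norm (shrink u - shrink v) * norm (u - v)"
    using shrink_firmly_nonexpansive[of u v] norm_cauchy_schwarz[of "shrink u - shrink v" "u - v"]
    by (simp add: power2_eq_square)
  then show ?thesis
    by (cases "shrink u = shrink v") (auto simp: mult_le_cancel_left_pos)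
qed

text \<open>The gap is exactly \<open>shrink u \<bullet> (proj_box u - proj_box v)\<close> plus half
  the squared norm of \<open>shrink v - shrink u\<close>.\<close>

lemma half_norm2_shrink_lower:
  fixes u v :: "real^'q"
  shows "(norm (shrink u))\<^sup>2 / 2 + shrink u \<bullet> (v - u) \<le> (norm (shrink v))\<^sup>2 / 2"
proof -
  have "0 \<le> shrink u \<bullet> (proj_box u - proj_box v)"
    by (rule shrink_variational, rule abs_proj_box_le_1)
  moreover have "0 \<le> (norm (shrink v - shrink u))\<^sup>2" by simp
  ultimately show ?thesis
    by (simp add: power2_norm_eq_inner shrink_eq_diff_proj_box field_simps inner_diff_left inner_diff_right inner_add_left inner_add_right inner_commute)
qed

text \<open>Since \<open>shrink u + (v - u) = shrink v + (proj_box v - proj_box u)\<close>,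
  completing the square leaves the gap \<open>shrink v \<bullet> (proj_box v - proj_box u)\<close>
  plus half a square.\<close>

lemma half_norm2_shrink_upper:
  fixes u v :: "real^'q"
  shows "(norm (shrink v))\<^sup>2 / 2 \<le> (norm (shrink u))\<^sup>2 / 2 + shrink u \<bullet> (v - u) + (norm (v - u))\<^sup>2 / 2"
proof -
  have "0 \<le> shrink v \<bullet> (proj_box v - proj_box u)"
    by (rule shrink_variational, rule abs_proj_box_le_1)
  moreover have "0 \<le> (norm (proj_box v - proj_box u))\<^sup>2" by simp
  ultimately show ?thesis
    by (simp add: power2_norm_eq_inner shrink_eq_diff_proj_box field_simps inner_diff_left inner_diff_right inner_add_left inner_add_right inner_commute)
qed

section \<open>Transposes and the spectral norm\<close>

lemma inner_matrix_vector_mult_left: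
  fixes M :: "real^'q^'p"
  shows "(M *v y) \<bullet> x = y \<bullet> (transpose M *v x)"
  by (metis dot_lmul_matrix inner_commute transpose_matrix_vector)

lemma norm_matrix_vector_mult_le:
  fixes M :: "real^'q^'p"
  shows "norm (M *v x) \<le> spectral_norm M * norm x"
  by (rule onorm) (rule matrix_vector_mul_bounded_linear)

lemma spectral_norm_nonneg: "0 \<le> spectral_norm (M :: real^'q^'p)"
  by (rule onorm_pos_le) (rule matrix_vector_mul_bounded_linear)

lemma norm_transpose_mult_le:
  fixes M :: "real^'q^'p"
  shows "norm (transpose M *v x) \<le> spectral_norm M * norm x"
proof -
  let ?y = "transpose M *v x"
  have "norm ?y * norm ?y = x \<bullet> (M *v ?y)"
    using inner_matrix_vector_mult_left[of M ?y x]
    by (simp only: power2_norm_eq_inner[symmetric] power2_eq_square inner_commute)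
  also have "\<dots> \<le> norm x * (spectral_norm M * norm ?y)"
    by (rule order_trans[OF norm_cauchy_schwarz]) (simp only: mult_left_mono norm_matrix_vector_mult_le norm_ge_zero)
  finally have "norm ?y * norm ?y \<le> norm ?y * (spectral_norm M * norm x)"
    by (simp only: mult_ac)
  then show ?thesis
    using spectral_norm_nonneg[of M]
    by (cases "?y = 0") (auto simp: mult_le_cancel_left_pos simp del: transpose_matrix_vector)
qed

section \<open>Quadratic bounds and cocoercivity for the local objectives\<close>

definition local_grad ::
  "real \<Rightarrow> ('q \<Rightarrow> 'n::finite) \<Rightarrow> real^'q^'p \<Rightarrow> real^'p \<Rightarrow> 'n \<Rightarrow> real^'p \<Rightarrow> real^'p" where
  "local_grad \<gamma> own A b i x =
     \<gamma> *\<^sub>R (block own A i *v shrink (transpose (block own A i) *v x)) - (1 / real CARD('n)) *\<^sub>R b"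

lemma local_obj_eq:
  fixes own :: "'q::finite \<Rightarrow> 'n::finite"
  shows "local_obj \<gamma> own A b i x =
    \<gamma> * ((norm (shrink (transpose (block own A i) *v x)))\<^sup>2 / 2) - 1 / real CARD('n) * (b \<bullet> x)"
  by (simp add: local_obj_def shrink_eq_diff_proj_box Let_def)

lemma local_obj_lower:
  assumes "\<gamma> \<ge> 0"
  shows "local_obj \<gamma> own A b i u + local_grad \<gamma> own A b i u \<bullet> (v - u) \<le> local_obj \<gamma> own A b i v"
proof -
  let ?B = "block own A i"
  have "\<gamma> * ((norm (shrink (transpose ?B *v u)))\<^sup>2 / 2 + shrink (transpose ?B *v u) \<bullet> (transpose ?B *v v - transpose ?B *v u))
      \<le> \<gamma> * ((norm (shrink (transpose ?B *v v)))\<^sup>2 / 2)"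
    by (intro mult_left_mono half_norm2_shrink_lower assms)
  then show ?thesis
    by (simp add: local_obj_eq local_grad_def inner_matrix_vector_mult_left inner_diff_left
        matrix_vector_mult_diff_distrib algebra_simps del: transpose_matrix_vector)
qed

lemma local_obj_upper:
  assumes "\<gamma> \<ge> 0" and L: "\<gamma> * (spectral_norm (block own A i))\<^sup>2 \<le> L"
  shows "local_obj \<gamma> own A b i v
    \<le> local_obj \<gamma> own A b i u + local_grad \<gamma> own A b i u \<bullet> (v - u) + L / 2 * (norm (v - u))\<^sup>2"
proof -
  let ?B = "block own A i"
  have "\<gamma> * ((norm (shrink (transpose ?B *v v)))\<^sup>2 / 2)
     \<le> \<gamma> * ((norm (shrink (transpose ?B *v u)))\<^sup>2 / 2 + shrink (transpose ?B *v u) \<bullet> (transpose ?B *v v - transpose ?B *v u)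
       + (norm (transpose ?B *v v - transpose ?B *v u))\<^sup>2 / 2)"
    by (intro mult_left_mono half_norm2_shrink_upper assms)
  moreover have "\<gamma> * (norm (transpose ?B *v v - transpose ?B *v u))\<^sup>2 \<le> L * (norm (v - u))\<^sup>2"
  proof -
    have "norm (transpose ?B *v v - transpose ?B *v u) \<le> spectral_norm ?B * norm (v - u)"
      using norm_transpose_mult_le[of ?B "v - u"] by (simp only: matrix_vector_mult_diff_distrib)
    then have "(norm (transpose ?B *v v - transpose ?B *v u))\<^sup>2 \<le> (spectral_norm ?B)\<^sup>2 * (norm (v - u))\<^sup>2"
      by (metis norm_ge_zero power_mono power_mult_distrib)
    then have "\<gamma> * (norm (transpose ?B *v v - transpose ?B *v u))\<^sup>2 \<le> (\<gamma> * (spectral_norm ?B)\<^sup>2) * (norm (v - u))\<^sup>2"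
      using assms(1) by (metis mult.assoc mult_left_mono)
    also have "\<dots> \<le> L * (norm (v - u))\<^sup>2"
      by (intro mult_right_mono L) simp
    finally show ?thesis .
  qed
  ultimately show ?thesis
    by (simp add: local_obj_eq local_grad_def inner_matrix_vector_mult_left inner_diff_left
        matrix_vector_mult_diff_distrib algebra_simps del: transpose_matrix_vector)
qed

lemma norm_local_grad_diff_le:
  assumes "\<gamma> \<ge> 0"
  shows "norm (local_grad \<gamma> own A b i u - local_grad \<gamma> own A b i v)
    \<le> \<gamma> * (spectral_norm (block own A i))\<^sup>2 * norm (u - v)"
proof -
  let ?B = "block own A i" and ?s = "\<lambda>x. shrink (transpose (block own A i) *v x)"
  have "norm (local_grad \<gamma> own A b i u - local_grad \<gamma> own A b i v) = \<gamma> * norm (?B *v (?s u - ?s v))"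
    using assms by (simp add: local_grad_def matrix_vector_mult_diff_distrib flip: scaleR_diff_right)
  also have "\<dots> \<le> \<gamma> * (spectral_norm ?B * norm (?s u - ?s v))"
    by (intro mult_left_mono norm_matrix_vector_mult_le assms)
  also have "norm (?s u - ?s v) \<le> norm (transpose ?B *v (u - v))"
    by (simp only: matrix_vector_mult_diff_distrib norm_shrink_diff_le)
  also have "\<dots> \<le> spectral_norm ?B * norm (u - v)"
    by (rule norm_transpose_mult_le)
  finally show ?thesis
    using assms by (simp add: power2_eq_square mult_left_mono spectral_norm_nonneg mult.assoc)
qed

text \<open>Firm nonexpansiveness of \<open>shrink\<close>, carried over by moving the block across
  the inner product; the constant is the same as in the Lipschitz bound.\<close>

lemma local_grad_cocoercive:
  assumes "\<gamma> \<ge> 0"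
  shows "(norm (local_grad \<gamma> own A b i u - local_grad \<gamma> own A b i v))\<^sup>2
    \<le> \<gamma> * (spectral_norm (block own A i))\<^sup>2 *
       ((local_grad \<gamma> own A b i u - local_grad \<gamma> own A b i v) \<bullet> (u - v))"
proof -
  let ?B = "block own A i" and ?s = "\<lambda>x. shrink (transpose (block own A i) *v x)"
  have eq: "local_grad \<gamma> own A b i u - local_grad \<gamma> own A b i v = \<gamma> *\<^sub>R (?B *v (?s u - ?s v))"
    by (simp add: local_grad_def matrix_vector_mult_diff_distrib flip: scaleR_diff_right)
  have "(norm (?B *v (?s u - ?s v)))\<^sup>2 \<le> (spectral_norm ?B * norm (?s u - ?s v))\<^sup>2"
    by (intro power_mono norm_matrix_vector_mult_le norm_ge_zero)
  also have "\<dots> \<le> (spectral_norm ?B)\<^sup>2 * ((?s u - ?s v) \<bullet> (transpose ?B *v (u - v)))"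
    using shrink_firmly_nonexpansive[of "transpose ?B *v u" "transpose ?B *v v"]
    by (simp only: power_mult_distrib matrix_vector_mult_diff_distrib mult_left_mono zero_le_power2)
  finally have "\<gamma>\<^sup>2 * (norm (?B *v (?s u - ?s v)))\<^sup>2
    \<le> \<gamma>\<^sup>2 * ((spectral_norm ?B)\<^sup>2 * ((?s u - ?s v) \<bullet> (transpose ?B *v (u - v))))"
    by (intro mult_left_mono) simp_all
  moreover have "(norm (\<gamma> *\<^sub>R (?B *v (?s u - ?s v))))\<^sup>2 = \<gamma>\<^sup>2 * (norm (?B *v (?s u - ?s v)))\<^sup>2"
    by (simp only: norm_scaleR power_mult_distrib power2_abs)
  moreover have "\<gamma> * (spectral_norm ?B)\<^sup>2 * ((\<gamma> *\<^sub>R (?B *v (?s u - ?s v))) \<bullet> (u - v))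
      = \<gamma>\<^sup>2 * ((spectral_norm ?B)\<^sup>2 * ((?s u - ?s v) \<bullet> (transpose ?B *v (u - v))))"
    by (simp only: inner_scaleR_left inner_matrix_vector_mult_left power2_eq_square mult_ac)
  ultimately show ?thesis
    unfolding eq by (simp only:)
qed

text \<open>The linearization error is at most \<open>\<bar>L\<bar>\<close> times the squared step,
  hence of smaller order; no projection has to be differentiated.\<close>

lemma gderiv_if_quadratic_sandwich:
  fixes f :: "'a::euclidean_space \<Rightarrow> real"
  assumes lower: "\<And>y. f x + g \<bullet> (y - x) \<le> f y"
    and upper: "\<And>y. f y \<le> f x + g \<bullet> (y - x) + L * (norm (y - x))\<^sup>2"
  shows "GDERIV f x :> g"
  unfolding gderiv_def has_derivative_at
proof
  show "bounded_linear (\<lambda>h. h \<bullet> g)" by (rule bounded_linear_inner_left)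
  have "norm (norm (f (x + h) - f x - h \<bullet> g) / norm h) \<le> \<bar>L\<bar> * norm h" for h
  proof (cases "h = 0")
    case False
    have "\<bar>f (x + h) - f x - h \<bullet> g\<bar> \<le> \<bar>L\<bar> * norm h * norm h"
      using lower[of "x + h"] upper[of "x + h"] mult_right_mono[OF abs_ge_self, of "(norm h)\<^sup>2" L]
      by (simp add: inner_commute power2_eq_square mult.assoc)
    with False show ?thesis by (simp add: divide_le_eq)
  qed simp
  moreover have "(\<lambda>h::'a. \<bar>L\<bar> * norm h) \<midarrow>0\<rightarrow> 0"
    by (rule tendsto_eq_intros refl | simp)+
  ultimately show "(\<lambda>h. norm (f (x + h) - f x - h \<bullet> g) / norm h) \<midarrow>0\<rightarrow> 0"
    by (rule Lim_null_comparison[OF always_eventually[OF allI]])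
qed

lemma gradient_eqI:
  assumes "GDERIV f x :> g"
  shows "gradient f x = g"
  unfolding gradient_def
proof (rule the_equality)
  fix h assume "GDERIV f x :> h"
  then have "(\<lambda>y. y \<bullet> h) = (\<lambda>y. y \<bullet> g)"
    using assms unfolding gderiv_def by (rule has_derivative_unique)
  then show "h = g"
    by (metis inner_commute vector_eq_ldot)
qed (rule assms)

text \<open>Evaluate the quadratic upper bound at its minimizer, the gradient step of length
  \<open>1 / L\<close>.\<close>

lemma norm2_grad_le:
  fixes f :: "'a::real_inner \<Rightarrow> real"
  assumes upper: "\<And>y. f y \<le> f x + g \<bullet> (y - x) + L / 2 * (norm (y - x))\<^sup>2"
    and "L > 0" and "\<And>y. m \<le> f y"
  shows "(norm g)\<^sup>2 \<le> 2 * L * (f x - m)"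
proof -
  have "m \<le> f (x - (1 / L) *\<^sub>R g)" by fact
  also have "\<dots> \<le> f x + g \<bullet> (x - (1 / L) *\<^sub>R g - x) + L / 2 * (norm (x - (1 / L) *\<^sub>R g - x))\<^sup>2"
    by (rule upper)
  also have "\<dots> = f x - (norm g)\<^sup>2 / (2 * L)"
    using \<open>L > 0\<close> by (simp add: power_mult_distrib power2_norm_eq_inner[symmetric] field_simps power2_eq_square)
  finally show ?thesis
    using \<open>L > 0\<close> by (simp add: field_simps)
qed

section \<open>Spectral bounds for the mixing matrix\<close>

text \<open>A unit vector maximising the Rayleigh quotient over an invariant subspace is an eigenvector:
  there the positive semidefinite form \<open>\<mu> \<bar>v\<bar>\<^sup>2 - v \<bullet> M v\<close> vanishes, and so does its differential.\<close>

lemma symmetric_max_eigenvector: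
  fixes M :: "real^'n^'n"
  assumes sym: "transpose M = M"
    and S: "subspace S" "\<And>v. v \<in> S \<Longrightarrow> M *v v \<in> S" "S \<noteq> {0}"
  obtains \<mu> u where "u \<in> S" "u \<noteq> 0" "M *v u = \<mu> *\<^sub>R u"
    "\<And>v. v \<in> S \<Longrightarrow> v \<bullet> (M *v v) \<le> \<mu> * (norm v)\<^sup>2"
proof -
  let ?K = "S \<inter> sphere 0 1"
  have sym': "a \<bullet> (M *v c) = c \<bullet> (M *v a)" for a c
    by (metis dot_lmul_matrix inner_commute sym transpose_matrix_vector)
  have "compact ?K"
    using S(1) by (intro closed_Int_compact closed_subspace) auto
  moreover obtain w where w: "w \<in> S" "w \<noteq> 0"
    using S(1,3) subspace_0 by blast
  then have "(1 / norm w) *\<^sub>R w \<in> ?K"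
    using S(1) by (auto simp: subspace_scale)
  moreover have "continuous_on ?K (\<lambda>v. v \<bullet> (M *v v))"
    by (intro continuous_intros linear_continuous_on matrix_vector_mul_bounded_linear)
  ultimately obtain u where u: "u \<in> ?K" and max: "\<And>v. v \<in> ?K \<Longrightarrow> v \<bullet> (M *v v) \<le> u \<bullet> (M *v u)"
    using continuous_attains_sup[of ?K "\<lambda>v. v \<bullet> (M *v v)"] by blast
  define \<mu> where "\<mu> = u \<bullet> (M *v u)"
  have bound: "v \<bullet> (M *v v) \<le> \<mu> * (norm v)\<^sup>2" if "v \<in> S" for v
  proof (cases "v = 0")
    case False
    have "(1 / norm v) *\<^sub>R v \<in> ?K"
      using that False S(1) by (auto simp: subspace_scale)
    from max[OF this] False show ?thesis
      by (simp add: \<mu>_def matrix_vector_mult_scaleR field_simps power2_eq_square)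
  qed simp
  have uS: "u \<in> S" and nu: "norm u = 1" using u by auto
  \<comment> \<open>Half the gradient at \<open>u\<close> of the semidefinite form; along it the
    form has the first-order change \<open>2 * t * (?d \<bullet> ?d)\<close>.\<close>
  let ?d = "\<mu> *\<^sub>R u - M *v u"
  have dS: "?d \<in> S" using uS S by (simp add: subspace_diff subspace_scale)
  let ?C = "\<mu> * (norm ?d)\<^sup>2 - ?d \<bullet> (M *v ?d)"
  have key: "0 \<le> 2 * t * (?d \<bullet> ?d) + t\<^sup>2 * ?C" for t
  proof -
    have "u + t *\<^sub>R ?d \<in> S" using uS dS S(1) by (simp add: subspace_add subspace_scale)
    from bound[OF this] have "0 \<le> \<mu> * ((u + t *\<^sub>R ?d) \<bullet> (u + t *\<^sub>R ?d)) - (u + t *\<^sub>R ?d) \<bullet> (M *v (u + t *\<^sub>R ?d))"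
      by (simp add: power2_norm_eq_inner)
    also have "\<dots> = \<mu> * (u \<bullet> u) - u \<bullet> (M *v u) + 2 * t * (\<mu> * (u \<bullet> ?d) - ?d \<bullet> (M *v u)) + t\<^sup>2 * ?C"
      using sym'[of u ?d]
      by (simp only: matrix_vector_right_distrib matrix_vector_mult_scaleR inner_add_left inner_add_right
          inner_scaleR_left inner_scaleR_right inner_commute[of ?d u] power2_norm_eq_inner)
         (simp add: algebra_simps power2_eq_square)
    also have "\<mu> * (u \<bullet> u) - u \<bullet> (M *v u) = 0"
      using nu by (simp add: \<mu>_def power2_norm_eq_inner[symmetric])
    also have "\<mu> * (u \<bullet> ?d) - ?d \<bullet> (M *v u) = ?d \<bullet> ?d"
      by (simp add: algebra_simps inner_commute)
    finally show ?thesis by simp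
  qed
  have "?d \<bullet> ?d = 0"
  proof (rule ccontr)
    assume "?d \<bullet> ?d \<noteq> 0"
    then have pos: "?d \<bullet> ?d > 0" by simp
    \<comment> \<open>Negative and so small that the linear term outweighs the quadratic one; the
      \<open>+ 1\<close> keeps the denominator positive.\<close>
    define t where "t = - (?d \<bullet> ?d) / (\<bar>?C\<bar> + 1)"
    have t: "t < 0" "t * (\<bar>?C\<bar> + 1) = - (?d \<bullet> ?d)"
      using pos by (simp_all add: t_def divide_neg_pos)
    have "t\<^sup>2 * ?C \<le> t\<^sup>2 * (\<bar>?C\<bar> + 1)" by (intro mult_left_mono) auto
    also have "\<dots> = - t * (?d \<bullet> ?d)" using t(2) by (simp add: power2_eq_square mult.assoc)
    finally have "2 * t * (?d \<bullet> ?d) + t\<^sup>2 * ?C \<le> t * (?d \<bullet> ?d)" by simp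
    also have "\<dots> < 0" using t(1) pos by (rule mult_neg_pos)
    finally show False using key[of t] by simp
  qed
  then have "M *v u = \<mu> *\<^sub>R u" by simp
  moreover have "u \<noteq> 0" using nu by auto
  ultimately show ?thesis using that uS bound by blast
qed

section \<open>Eigenvalues as roots of the characteristic polynomial\<close>

lemma poly_charpoly: "poly (charpoly M) t = det (mat t - M)"
  unfolding charpoly_def det_def
  by (simp add: poly_sum poly_mult poly_prod mat_def of_int_poly if_distrib[of "\<lambda>p. poly p t"] cong: if_cong)

lemma eigenvector_imp_charpoly_root:
  fixes M :: "real^'n^'n"
  assumes "M *v u = \<mu> *\<^sub>R u" "u \<noteq> 0"
  shows "poly (charpoly M) \<mu> = 0"
proof -
  have "(mat \<mu> - M) *v u = 0"
    by (simp add: matrix_vector_mult_diff_rdistrib assms(1))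
       (simp add: vec_eq_iff matrix_vector_mult_def mat_def if_distrib if_distribR cong: if_cong)
  then have "\<not> invertible (mat \<mu> - M)"
    using assms(2) by (metis inj_matrix_vector_mult injD matrix_vector_mult_0_right)
  then show ?thesis
    by (simp add: poly_charpoly invertible_det_nz)
qed

lemma eigenvalue_listE:
  fixes M :: "real^'n^'n"
  assumes "eigenvalue_list M lam" "M *v u = \<mu> *\<^sub>R u" "u \<noteq> 0"
  obtains k where "1 \<le> k" "k \<le> CARD('n)" "\<mu> = lam k"
proof -
  have "(\<Prod>k = 1..CARD('n). poly [:- lam k, 1:] \<mu>) = 0"
    using eigenvector_imp_charpoly_root[OF assms(2,3)] assms(1)
    by (simp add: eigenvalue_list_def poly_prod)
  then show ?thesis using that by auto
qed

text \<open>Two independent eigenvectors for 1 give a double root of the characteristic polynomial: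
  replacing two columns of the identity by them yields an invertible \<open>P\<close> for which
  two columns of \<open>(t - W) P\<close> are divisible by \<open>t - 1\<close>.\<close>

lemma charpoly_double_root:
  fixes W :: "real^'n^'n"
  assumes W1: "W *v 1 = 1" and Wv: "W *v v = v" and neq: "v $ j \<noteq> v $ l"
  obtains q where "\<And>t. poly (charpoly W) t = (t - 1)\<^sup>2 * q t" "continuous_on UNIV q"
proof -
  have jl: "j \<noteq> l" using neq by auto
  define P :: "real^'n^'n" where
    "P = (\<chi> r c. if c = j then 1 else if c = l then v $ r else if r = c then 1 else 0)"
  \<comment> \<open>Transposed, since the scalars are taken out of rows: row \<open>c\<close> is
    column \<open>c\<close> of \<open>(mat t - W) ** P\<close>, with the factor \<open>t - 1\<close>
    removed for \<open>c = j\<close> and \<open>c = l\<close>.\<close>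
  define cols :: "real \<Rightarrow> real^'n^'n" where
    "cols t = (\<chi> c. if c = j then 1 else if c = l then v else (mat t - W) *v axis c 1)" for t
  have P_col: "column c P = (if c = j then 1 else if c = l then v else axis c 1)" for c
    by (auto simp: P_def column_def vec_eq_iff axis_def)
  have "invertible P"
  proof -
    have "w = 0" if "P *v w = 0" for w
    proof -
      have Pw: "(\<Sum>c\<in>UNIV. P $ r $ c * w $ c) = 0" for r
        using that by (simp add: vec_eq_iff matrix_vector_mult_def)
      have split: "(\<Sum>c\<in>UNIV. P $ r $ c * w $ c)
          = w $ j + v $ r * w $ l + (\<Sum>c\<in>UNIV - {j,l}. if r = c then w $ c else 0)" for r
      proof -
        have "(\<Sum>c\<in>UNIV. P $ r $ c * w $ c) = (\<Sum>c\<in>{j,l}. P $ r $ c * w $ c) + (\<Sum>c\<in>UNIV-{j,l}. P $ r $ c * w $ c)"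
          by (metis (no_types) finite_class.finite_UNIV sum.subset_diff subset_UNIV add.commute)
        also have "(\<Sum>c\<in>UNIV-{j,l}. P $ r $ c * w $ c) = (\<Sum>c\<in>UNIV - {j,l}. if r = c then w $ c else 0)"
          by (rule sum.cong) (auto simp: P_def)
        finally show ?thesis using jl by (simp add: P_def)
      qed
      have j0: "w $ j + v $ j * w $ l = 0" and l0: "w $ j + v $ l * w $ l = 0"
        using Pw[of j] Pw[of l] by (auto simp: split sum.delta')
      then have "(v $ j - v $ l) * w $ l = 0" unfolding left_diff_distrib by linarith
      then have wl: "w $ l = 0" using neq by simp
      then have wj: "w $ j = 0" using j0 by simp
      show "w = 0"
      proof (rule vec_eq_iff[THEN iffD2], rule allI)
        fix r show "w $ r = 0 $ r"
          using Pw[of r] wl wj by (cases "r \<in> {j, l}") (auto simp: split sum.delta')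
      qed
    qed
    then show ?thesis
      by (metis invertible_left_inverse matrix_left_invertible_ker)
  qed
  then have detP: "det P \<noteq> 0" by (simp add: invertible_det_nz)
  have mat_mul: "mat t *v (y::real^'n) = t *\<^sub>R y" for t y
    by (simp add: vec_eq_iff matrix_vector_mult_def mat_def if_distrib if_distribR cong: if_cong)
  have rows: "transpose ((mat t - W) ** P) =
      (\<chi> c. if c = j then (t - 1) *s 1 else if c = l then (t - 1) *s v else (mat t - W) *v axis c 1)" for t
  proof -
    have "transpose ((mat t - W) ** P) $ c = (mat t - W) *v column c P" for c
      by (simp add: vec_eq_iff transpose_def matrix_matrix_mult_def matrix_vector_mult_def column_def)
    moreover have "(mat t - W) *v 1 = (t - 1) *s 1" "(mat t - W) *v v = (t - 1) *s v"
      by (simp_all add: matrix_vector_mult_diff_rdistrib mat_mul W1 Wv vec_eq_iff algebra_simps)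
    ultimately show ?thesis by (auto simp: P_col vec_eq_iff)
  qed
  have eq: "poly (charpoly W) t * det P = (t - 1)\<^sup>2 * det (cols t)" for t
  proof -
    have "poly (charpoly W) t * det P = det (transpose ((mat t - W) ** P))"
      by (simp add: poly_charpoly det_mul)
    also have "\<dots> = (t - 1) * det (\<chi> c. if c = j then 1 else if c = l then (t - 1) *s v else (mat t - W) *v axis c 1 :: real^'n^'n)"
      unfolding rows by (rule det_row_mul)
    also have "(\<chi> c. if c = j then 1 else if c = l then (t - 1) *s v else (mat t - W) *v axis c 1 :: real^'n^'n)
       = (\<chi> c. if c = l then (t - 1) *s v else if c = j then 1 else (mat t - W) *v axis c 1)"
      using jl by (auto simp: vec_eq_iff)
    also have "det \<dots> = (t - 1) * det (\<chi> c. if c = l then v else if c = j then 1 else (mat t - W) *v axis c 1 :: real^'n^'n)"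
      by (rule det_row_mul)
    also have "(\<chi> c. if c = l then v else if c = j then 1 else (mat t - W) *v axis c 1 :: real^'n^'n) = cols t"
      using jl by (auto simp: vec_eq_iff cols_def)
    finally show ?thesis by (simp add: power2_eq_square)
  qed
  show ?thesis
  proof (rule that)
    show "poly (charpoly W) t = (t - 1)\<^sup>2 * (det (cols t) / det P)" for t
      using eq[of t] detP by (simp add: field_simps)
    have "continuous_on UNIV (\<lambda>t. cols t $ r $ c)" for r c
      by (cases "r = j"; cases "r = l")
         (auto simp: cols_def matrix_vector_mult_diff_rdistrib mat_mul intro!: continuous_intros)
    then have "continuous_on UNIV (\<lambda>t. det (cols t))"
      unfolding det_def
      by (intro continuous_on_sum continuous_on_mult continuous_on_const continuous_on_prod)
    then show "continuous_on UNIV (\<lambda>t. det (cols t) / det P)"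
      using detP by (intro continuous_on_divide continuous_on_const) auto
  qed
qed

text \<open>Otherwise 1 is a simple root. The cofactor \<open>r\<close> equals
  \<open>(t - 1) * q t\<close> away from 1 and both are continuous, so \<open>r 1 = 0\<close>; then
  some \<open>lam k\<close> with \<open>2 \<le> k\<close> equals 1, against the ordering.\<close>

lemma second_eigenvalue_eq_1:
  fixes W :: "real^'n^'n"
  assumes ev: "eigenvalue_list W lam" "lam 1 = 1" and card: "2 \<le> CARD('n)"
    and W1: "W *v 1 = 1" and Wv: "W *v v = v" and neq: "v $ j \<noteq> v $ l"
  shows "lam 2 = 1"
proof (rule ccontr)
  assume ne: "lam 2 \<noteq> 1"
  have lt: "lam k < 1" if "k \<in> {2..CARD('n)}" for k
  proof -
    have "lam 2 \<le> lam 1" "lam k \<le> lam 2"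
      using ev(1) card that unfolding eigenvalue_list_def atLeastAtMost_iff
      by (meson one_le_numeral order_refl)+
    with ne ev show ?thesis by simp
  qed
  define r where "r t = (\<Prod>k = 2..CARD('n). t - lam k)" for t
  obtain q where q: "\<And>t. poly (charpoly W) t = (t - 1)\<^sup>2 * q t" "continuous_on UNIV q"
    using charpoly_double_root[OF W1 Wv neq] by blast
  have split: "poly (charpoly W) t = (t - 1) * r t" for t
  proof -
    have "{1..CARD('n)} = insert 1 {2..CARD('n)}" using card by auto
    then show ?thesis
      using ev by (simp add: eigenvalue_list_def poly_prod r_def left_diff_distrib)
  qed
  have "r t = (t - 1) * q t" if "t \<noteq> 1" for t
    using split[of t] q(1)[of t] that by (simp add: power2_eq_square)
  then have "eventually (\<lambda>t. r t = (t - 1) * q t) (at 1)"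
    by (auto simp: eventually_at_filter)
  moreover have "isCont q 1" using q(2) by (simp add: continuous_on_eq_continuous_at)
  then have "((\<lambda>t. (t - 1) * q t) \<longlongrightarrow> (1 - 1) * q 1) (at 1)"
    by (intro tendsto_intros) (simp add: isCont_def)
  ultimately have "(r \<longlongrightarrow> 0) (at 1)" by (simp add: tendsto_cong)
  moreover have "(r \<longlongrightarrow> r 1) (at 1)"
    unfolding r_def by (intro tendsto_intros)
  ultimately have "r 1 = 0" by (rule tendsto_unique[OF trivial_limit_at, rotated])
  then obtain k where "k \<in> {2..CARD('n)}" "lam k = 1" by (auto simp: r_def)
  then show False using lt[of k] by simp
qed

text \<open>Maximise the quadratic form of \<open>- W\<close> over the unit vectors: the maximum
  \<open>\<mu>\<close> is an eigenvalue of \<open>- W\<close>, so \<open>- \<mu>\<close> is in the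
  list and at least its last entry.\<close>

lemma symmetric_quadratic_form_ge:
  fixes W :: "real^'n^'n"
  assumes sym: "transpose W = W" and ev: "eigenvalue_list W lam"
  shows "lam CARD('n) * (norm v)\<^sup>2 \<le> v \<bullet> (W *v v)"
proof -
  have neg: "(- W) *v y = - (W *v y)" for y
    by (simp add: vec_eq_iff matrix_vector_mult_def sum_negf)
  have "transpose (- W) = - W" using sym by (simp add: vec_eq_iff transpose_def)
  moreover have "(UNIV :: (real^'n) set) \<noteq> {0}"
    by (metis UNIV_I axis_eq_0_iff singletonD zero_neq_one)
  ultimately obtain \<mu> u where u: "u \<noteq> 0" "(- W) *v u = \<mu> *\<^sub>R u"
    and le: "\<And>v. v \<bullet> ((- W) *v v) \<le> \<mu> * (norm v)\<^sup>2"
    using symmetric_max_eigenvector[OF _ subspace_UNIV UNIV_I, of "- W"] by (metis UNIV_I)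
  have "W *v u = (- \<mu>) *\<^sub>R u" using u(2) by (simp add: neg minus_equation_iff[of _ "\<mu> *\<^sub>R u"] eq_commute)
  then obtain k where "1 \<le> k" "k \<le> CARD('n)" "- \<mu> = lam k"
    using eigenvalue_listE[OF ev _ u(1)] by metis
  then have "lam CARD('n) \<le> - \<mu>"
    using ev by (simp add: eigenvalue_list_def)
  then have "lam CARD('n) * (norm v)\<^sup>2 \<le> - \<mu> * (norm v)\<^sup>2"
    by (rule mult_right_mono) simp
  then show ?thesis using le[of v] by (simp add: neg)
qed

text \<open>The largest eigenvalue of \<open>W\<^sup>2\<close> on the orthogonal complement of the constants is the square
  of an eigenvalue of \<open>W\<close> with an eigenvector there, hence of one of \<open>lam 2, \<dots>, lam n\<close>.\<close>

lemma norm_mixing_le_orthogonal_one: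
  fixes W :: "real^'n^'n"
  assumes sym: "transpose W = W" and W1: "W *v 1 = 1"
    and ev: "eigenvalue_list W lam" and lam1: "lam 1 = 1"
    and \<beta>: "\<beta> = max \<bar>lam 2\<bar> \<bar>lam CARD('n)\<bar>" "\<beta> < 1"
    and v: "1 \<bullet> v = 0"
  shows "norm (W *v v) \<le> \<beta> * norm v"
proof (cases "v = 0")
  case False
  define S where "S = {v :: real^'n. 1 \<bullet> v = 0}"
  have sym': "a \<bullet> (W *v c) = (W *v a) \<bullet> c" for a c
    by (metis dot_lmul_matrix sym transpose_matrix_vector)
  have S: "subspace S" unfolding S_def by (rule subspace_hyperplane)
  have WS: "W *v y \<in> S" if "y \<in> S" for y using that by (simp add: S_def sym' W1)
  have "v \<in> S" using v by (simp add: S_def)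
  have "transpose (W ** W) = W ** W" by (simp add: matrix_transpose_mul sym)
  then obtain \<mu> u where u: "u \<in> S" "u \<noteq> 0" "(W ** W) *v u = \<mu> *\<^sub>R u"
    and le: "\<And>v. v \<in> S \<Longrightarrow> v \<bullet> ((W ** W) *v v) \<le> \<mu> * (norm v)\<^sup>2"
    using symmetric_max_eigenvector[of "W ** W" S] S WS False \<open>v \<in> S\<close>
    by (metis (no_types, lifting) matrix_vector_mul_assoc singletonD)
  have W2: "y \<bullet> ((W ** W) *v y) = (norm (W *v y))\<^sup>2" for y
    by (simp add: sym' power2_norm_eq_inner flip: matrix_vector_mul_assoc)
  have "0 \<le> \<mu> * (norm u)\<^sup>2" using W2[of u] u(3) by (metis inner_scaleR_right power2_norm_eq_inner zero_le_power2)
  then have "0 \<le> \<mu>" using u(2) by (simp add: zero_le_mult_iff)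
  define s where "s = sqrt \<mu>"
  have s: "0 \<le> s" "s * s = \<mu>" using \<open>0 \<le> \<mu>\<close> by (simp_all add: s_def)
  \<comment> \<open>By \<open>(W - s) (W + s) u = 0\<close>, either the inner factor kills
    \<open>u\<close>, an eigenvector for \<open>- s\<close>, or it maps \<open>u\<close> to an
    eigenvector for \<open>s\<close>.\<close>
  have "\<exists>e \<tau>. e \<in> S \<and> e \<noteq> 0 \<and> W *v e = \<tau> *\<^sub>R e \<and> \<bar>\<tau>\<bar> = s"
  proof (cases "W *v u + s *\<^sub>R u = 0")
    case True
    then have "W *v u = (- s) *\<^sub>R u" by (simp add: eq_neg_iff_add_eq_0)
    then show ?thesis using u s by (intro exI[of _ u] exI[of _ "- s"]) auto
  next
    case False
    have "W *v (W *v u + s *\<^sub>R u) = s *\<^sub>R (W *v u + s *\<^sub>R u)"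
      using u(3) s(2) by (simp add: matrix_vector_right_distrib matrix_vector_mult_scaleR
          matrix_vector_mul_assoc scaleR_add_right add.commute)
    then show ?thesis using False u(1) WS S s
      by (intro exI[of _ "W *v u + s *\<^sub>R u"] exI[of _ s]) (auto simp: subspace_add subspace_scale)
  qed
  then obtain e \<tau> where e: "e \<in> S" "e \<noteq> 0" "W *v e = \<tau> *\<^sub>R e" "\<bar>\<tau>\<bar> = s" by blast
  obtain k where k: "1 \<le> k" "k \<le> CARD('n)" "\<tau> = lam k"
    using eigenvalue_listE[OF ev e(3,2)] by metis
  have "\<exists>j l. e $ j \<noteq> e $ l"
  proof (rule ccontr)
    assume "\<not> ?thesis"
    then have "e = (e $ undefined) *\<^sub>R 1" by (auto simp: vec_eq_iff)
    moreover have "1 \<bullet> e = 0" using e(1) by (simp add: S_def)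
    ultimately show False using e(2) by (metis inner_eq_zero_iff inner_scaleR_left mult_zero_right)
  qed
  then obtain j l where jl: "e $ j \<noteq> e $ l" by blast
  have card: "2 \<le> CARD('n)"
    using jl card_mono[of UNIV "{j, l}"] by (cases "j = l") auto
  \<comment> \<open>For \<open>k = 1\<close> the eigenvalue 1 would occur on the complement of the
    constants as well; it is then a double root, so \<open>lam 2 = 1\<close>, contradicting
    \<open>\<beta> < 1\<close>.\<close>
  have "\<bar>lam k\<bar> \<le> \<beta>"
  proof (cases "k = 1")
    case True
    then have "lam 2 = 1"
      using second_eigenvalue_eq_1[OF ev lam1 card W1 _ jl] e(3) k(3) lam1 by simp
    with \<beta> show ?thesis by simp
  next
    case False
    then have "lam k \<le> lam 2" "lam CARD('n) \<le> lam k"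
      using ev k unfolding eigenvalue_list_def by auto
    then show ?thesis unfolding \<beta>(1) by auto
  qed
  then have "s \<le> \<beta>" using e(4) k(3) by simp
  have "(norm (W *v v))\<^sup>2 \<le> (s * norm v)\<^sup>2"
    using le[OF \<open>v \<in> S\<close>] s(2)[folded power2_eq_square] by (simp add: W2 power_mult_distrib)
  then have "norm (W *v v) \<le> s * norm v"
    using s(1) by (simp add: power2_le_iff_abs_le)
  also have "\<dots> \<le> \<beta> * norm v" using \<open>s \<le> \<beta>\<close> by (rule mult_right_mono) simp
  finally show ?thesis .
qed simp

section \<open>Decentralized gradient descent\<close>

definition mix :: "real^'n^'n \<Rightarrow> 'a::real_vector^'n \<Rightarrow> 'a^'n" where
  "mix W X = (\<chi> i. \<Sum>j\<in>UNIV. W $ i $ j *\<^sub>R X $ j)"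

text \<open>The \<open>r\<close>-th coordinates of all agents as one vector. \<open>mix W\<close>
  acts on each such slice as \<open>W\<close>, so bounds for \<open>W\<close> transfer slice by
  slice.\<close>

definition coord :: "'a::euclidean_space \<Rightarrow> 'a^'n \<Rightarrow> real^'n" where
  "coord r X = (\<chi> i. X $ i \<bullet> r)"

definition mean :: "'a::real_vector^'n \<Rightarrow> 'a" where
  "mean X = (1 / real CARD('n)) *\<^sub>R (\<Sum>i\<in>UNIV. X $ i)"

definition dev :: "'a::real_vector^'n \<Rightarrow> 'a^'n" where
  "dev X = X - (\<chi> i. mean X)"

lemma inner_eq_sum_coord: "X \<bullet> Y = (\<Sum>r\<in>Basis. coord r X \<bullet> coord r Y)"
  for X Y :: "'a::euclidean_space^'n"
proof -
  have "X \<bullet> Y = (\<Sum>i\<in>UNIV. \<Sum>r\<in>Basis. (X $ i \<bullet> r) * (Y $ i \<bullet> r))"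
    unfolding inner_vec_def by (rule sum.cong[OF refl], rule euclidean_inner)
  also have "\<dots> = (\<Sum>r\<in>Basis. \<Sum>i\<in>UNIV. (X $ i \<bullet> r) * (Y $ i \<bullet> r))"
    by (rule sum.swap)
  finally show ?thesis by (simp add: inner_vec_def coord_def)
qed

lemma norm2_eq_sum_coord: "(norm X)\<^sup>2 = (\<Sum>r\<in>Basis. (norm (coord r X))\<^sup>2)"
  for X :: "'a::euclidean_space^'n"
  unfolding power2_norm_eq_inner by (rule inner_eq_sum_coord)

lemma norm2_vec: "(norm X)\<^sup>2 = (\<Sum>i\<in>UNIV. (norm (X $ i))\<^sup>2)" for X :: "'a::real_inner^'n"
  by (simp only: power2_norm_eq_inner inner_vec_def)

lemma coord_mix: "coord r (mix W X) = W *v coord r X"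
  by (simp add: coord_def mix_def matrix_vector_mult_def inner_sum_left vec_eq_iff)

lemma mix_add: "mix W (X + Y) = mix W X + mix W Y"
  by (simp add: mix_def vec_eq_iff scaleR_add_right sum.distrib)

lemma mix_diff: "mix W (X - Y) = mix W X - mix W Y"
  by (simp add: mix_def vec_eq_iff scaleR_diff_right sum_subtractf)

lemma inner_mix_commute:
  fixes X Y :: "'a::euclidean_space^'n"
  assumes "transpose W = W"
  shows "X \<bullet> mix W Y = mix W X \<bullet> Y"
proof -
  have "a \<bullet> (W *v c) = (W *v a) \<bullet> c" for a c
    by (metis dot_lmul_matrix assms transpose_matrix_vector)
  then show ?thesis
    unfolding inner_eq_sum_coord[of X] inner_eq_sum_coord[of "mix W X"] by (simp only: coord_mix)
qed

text \<open>Young's inequality for each pair of agents, weighted by the nonnegative entries of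
  \<open>W\<close>; unit row sums and unit column sums each contribute half of the squared
  norm.\<close>

lemma inner_mix_le_norm2:
  fixes X :: "'a::real_inner^'n"
  assumes "doubly_stochastic W"
  shows "X \<bullet> mix W X \<le> (norm X)\<^sup>2"
proof -
  have W: "0 \<le> W $ i $ j" "(\<Sum>j\<in>UNIV. W $ i $ j) = 1" "(\<Sum>i\<in>UNIV. W $ i $ j) = 1" for i j
    using assms by (simp_all add: doubly_stochastic_def)
  have "X \<bullet> mix W X = (\<Sum>i\<in>UNIV. \<Sum>j\<in>UNIV. W $ i $ j * (X $ i \<bullet> X $ j))"
    by (simp add: inner_vec_def mix_def inner_sum_right)
  also have "\<dots> \<le> (\<Sum>i\<in>UNIV. \<Sum>j\<in>UNIV. W $ i $ j * ((norm (X $ i))\<^sup>2 / 2 + (norm (X $ j))\<^sup>2 / 2))"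
  proof (intro sum_mono mult_left_mono W(1))
    fix i j
    have "0 \<le> (norm (X $ i - X $ j))\<^sup>2" by simp
    then show "X $ i \<bullet> X $ j \<le> (norm (X $ i))\<^sup>2 / 2 + (norm (X $ j))\<^sup>2 / 2"
      by (simp add: power2_norm_eq_inner inner_diff_left inner_diff_right inner_commute field_simps)
  qed
  also have "\<dots> = (\<Sum>i\<in>UNIV. \<Sum>j\<in>UNIV. W $ i $ j * ((norm (X $ i))\<^sup>2 / 2))
      + (\<Sum>i\<in>UNIV. \<Sum>j\<in>UNIV. W $ i $ j * ((norm (X $ j))\<^sup>2 / 2))"
    by (simp only: distrib_left sum.distrib)
  also have "(\<Sum>i\<in>UNIV. \<Sum>j\<in>UNIV. W $ i $ j * ((norm (X $ j))\<^sup>2 / 2))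
      = (\<Sum>j\<in>UNIV. \<Sum>i\<in>UNIV. W $ i $ j * ((norm (X $ j))\<^sup>2 / 2))"
    by (rule sum.swap)
  also have "(\<Sum>i\<in>UNIV. \<Sum>j\<in>UNIV. W $ i $ j * ((norm (X $ i))\<^sup>2 / 2)) + \<dots> = (norm X)\<^sup>2"
    by (simp only: sum_distrib_right[symmetric] W) (simp add: norm2_vec flip: sum_divide_distrib)
  finally show ?thesis .
qed

lemma mean_diff: "mean (X - Y) = mean X - mean Y"
  by (simp add: mean_def sum_subtractf scaleR_diff_right)

lemma mean_scaleR: "mean (a *\<^sub>R X) = a *\<^sub>R mean X"
  by (simp add: mean_def scaleR_sum_right[symmetric])

lemma mean_mix:
  assumes "doubly_stochastic W"
  shows "mean (mix W X) = mean X"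
proof -
  have "(\<Sum>i\<in>UNIV. mix W X $ i) = (\<Sum>j\<in>UNIV. (\<Sum>i\<in>UNIV. W $ i $ j) *\<^sub>R X $ j)"
    unfolding mix_def scaleR_sum_left by (simp, rule sum.swap)
  then show ?thesis using assms by (simp add: doubly_stochastic_def mean_def)
qed

lemma mix_const:
  assumes "doubly_stochastic W"
  shows "mix W (\<chi> i. a) = (\<chi> i. a)"
  using assms by (simp add: doubly_stochastic_def mix_def vec_eq_iff flip: scaleR_sum_left)

lemma dev_mix: "doubly_stochastic W \<Longrightarrow> dev (mix W X) = mix W (dev X)"
  by (simp add: dev_def mean_mix mix_diff mix_const)

lemma dev_diff: "dev (X - Y) = dev X - dev Y"
  by (simp add: dev_def mean_diff vec_eq_iff)

lemma dev_scaleR: "dev (a *\<^sub>R X) = a *\<^sub>R dev X"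
  by (simp add: dev_def mean_scaleR vec_eq_iff scaleR_diff_right)

lemma sum_dev: "(\<Sum>i\<in>UNIV. dev X $ i) = 0"
  by (simp add: dev_def mean_def sum_subtractf sum_constant_scaleR)

text \<open>Pythagoras: \<open>dev X\<close> is the orthogonal projection of \<open>X\<close> onto
  the stacked vectors with zero sum.\<close>

lemma norm_dev_le: "norm (dev X) \<le> norm X" for X :: "'a::real_inner^'n"
proof -
  have "(\<Sum>i\<in>UNIV. X $ i) = real CARD('n) *\<^sub>R mean X"
    by (simp add: mean_def)
  moreover have "X \<bullet> (\<chi> i. mean X) = (\<Sum>i\<in>UNIV. X $ i) \<bullet> mean X"
    by (simp add: inner_vec_def inner_sum_left)
  ultimately have "X \<bullet> (\<chi> i. mean X) = real CARD('n) * (mean X \<bullet> mean X)"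
    by simp
  moreover have "(\<chi> i::'n. mean X) \<bullet> (\<chi> i. mean X) = real CARD('n) * (mean X \<bullet> mean X)"
    by (simp add: inner_vec_def)
  ultimately have "(norm (dev X))\<^sup>2 = (norm X)\<^sup>2 - real CARD('n) * (mean X \<bullet> mean X)"
    by (simp add: dev_def power2_norm_eq_inner inner_diff_left inner_diff_right
        inner_commute[of "\<chi> i. mean X" X])
  also have "\<dots> \<le> (norm X)\<^sup>2" by simp
  finally show ?thesis by (rule power2_le_imp_le) simp
qed

lemma norm_mean_le:
  fixes X :: "'a::real_normed_vector^'n"
  assumes "\<And>i. norm (X $ i) \<le> c"
  shows "norm (mean X) \<le> c"
proof -
  have "norm (\<Sum>i\<in>UNIV. X $ i) \<le> real CARD('n) * c"
    using sum_norm_le[of UNIV "($) X" "\<lambda>_. c"] assms by simp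
  then have "norm (\<Sum>i\<in>UNIV. X $ i) / real CARD('n) \<le> c"
    by (simp only: pos_divide_le_eq zero_less_card_finite of_nat_0_less_iff mult.commute)
  then show ?thesis by (simp add: mean_def)
qed

section \<open>Inexact gradient steps and scalar recursions\<close>

lemma young_norm2_add:
  fixes a b :: "'a::real_inner"
  assumes "t > 0"
  shows "(norm (a + b))\<^sup>2 \<le> (1 + t) * (norm a)\<^sup>2 + (1 + 1 / t) * (norm b)\<^sup>2"
proof -
  have "0 \<le> (norm (t *\<^sub>R a - b))\<^sup>2 / t" using assms by simp
  also have "\<dots> = t * (norm a)\<^sup>2 - 2 * (a \<bullet> b) + (norm b)\<^sup>2 / t"
    using assms unfolding power2_norm_eq_inner inner_diff_left inner_diff_right inner_scaleR_left inner_scaleR_right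
    by (simp add: inner_commute field_simps)
  finally show ?thesis
    by (simp add: power2_norm_eq_inner inner_add_left inner_add_right inner_commute algebra_simps)
qed

text \<open>\<open>e\<close> is the error vector, \<open>g\<close> the exact and \<open>h\<close>
  the available gradient. In the exact step, \<open>\<alpha> \<le> c1\<close> lets coercivity absorb
  the squared gradient; Young's inequality with weight \<open>\<alpha> * \<delta>\<close> separates
  the gradient error, which is where \<delta> enters.\<close>

lemma perturbed_gradient_step:
  fixes e g h :: "'a::real_inner"
  assumes coer: "c1 * (norm g)\<^sup>2 + c2 * (norm e)\<^sup>2 \<le> g \<bullet> e"
    and \<alpha>: "0 < \<alpha>" "\<alpha> \<le> c1" and "0 \<le> c2" and "0 < \<delta>"
    and \<epsilon>: "norm (h - g) \<le> \<epsilon>"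
  shows "(norm (e - \<alpha> *\<^sub>R h))\<^sup>2
    \<le> (1 + \<alpha> * \<delta>) * (1 - \<alpha> * c2) * (norm e)\<^sup>2 + \<alpha> * (\<alpha> + inverse \<delta>) * \<epsilon>\<^sup>2"
proof -
  have "\<alpha> * \<alpha> * (norm g)\<^sup>2 \<le> \<alpha> * c1 * (norm g)\<^sup>2" "0 \<le> \<alpha> * c1 * (norm g)\<^sup>2" "0 \<le> \<alpha> * c2 * (norm e)\<^sup>2"
    using \<alpha> \<open>0 \<le> c2\<close> by (simp_all add: mult_left_mono mult_right_mono)
  moreover have "\<alpha> * (c1 * (norm g)\<^sup>2 + c2 * (norm e)\<^sup>2) \<le> \<alpha> * (g \<bullet> e)"
    using coer \<alpha>(1) by (rule mult_left_mono[OF _ less_imp_le])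
  moreover have "(norm (e - \<alpha> *\<^sub>R g))\<^sup>2 = (norm e)\<^sup>2 - 2 * (\<alpha> * (g \<bullet> e)) + \<alpha> * \<alpha> * (norm g)\<^sup>2"
    unfolding power2_norm_eq_inner inner_diff_left inner_diff_right inner_scaleR_left inner_scaleR_right
    by (simp add: inner_commute algebra_simps)
  ultimately have step: "(norm (e - \<alpha> *\<^sub>R g))\<^sup>2 \<le> (1 - \<alpha> * c2) * (norm e)\<^sup>2"
    by (simp add: algebra_simps)
  have err: "(norm (\<alpha> *\<^sub>R (g - h)))\<^sup>2 \<le> \<alpha>\<^sup>2 * \<epsilon>\<^sup>2"
    using \<epsilon> \<alpha>(1) by (simp add: power_mult_distrib power_mono norm_minus_commute)
  have td: "0 < \<alpha> * \<delta>" using \<alpha>(1) \<open>0 < \<delta>\<close> by simp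
  have "e - \<alpha> *\<^sub>R h = (e - \<alpha> *\<^sub>R g) + \<alpha> *\<^sub>R (g - h)"
    by (simp add: scaleR_diff_right)
  then have "(norm (e - \<alpha> *\<^sub>R h))\<^sup>2
      \<le> (1 + \<alpha> * \<delta>) * (norm (e - \<alpha> *\<^sub>R g))\<^sup>2 + (1 + 1 / (\<alpha> * \<delta>)) * (norm (\<alpha> *\<^sub>R (g - h)))\<^sup>2"
    by (metis young_norm2_add[OF td])
  also have "\<dots> \<le> (1 + \<alpha> * \<delta>) * ((1 - \<alpha> * c2) * (norm e)\<^sup>2) + (1 + 1 / (\<alpha> * \<delta>)) * (\<alpha>\<^sup>2 * \<epsilon>\<^sup>2)"
    using td by (intro add_mono mult_left_mono step err) simp_all
  also have "(1 + 1 / (\<alpha> * \<delta>)) * (\<alpha>\<^sup>2 * \<epsilon>\<^sup>2) = \<alpha> * (\<alpha> + inverse \<delta>) * \<epsilon>\<^sup>2"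
    using \<alpha>(1) \<open>0 < \<delta>\<close> by (simp add: field_simps power2_eq_square)
  finally show ?thesis by (simp only: mult.assoc)
qed

lemma affine_recursion_bound:
  fixes a :: "nat \<Rightarrow> real"
  assumes "\<And>k. a (Suc k) \<le> q * a k + r" and q: "0 \<le> q" "q < 1"
  shows "a k \<le> q ^ k * (a 0 - r / (1 - q)) + r / (1 - q)"
proof (induction k)
  case (Suc k)
  have "a (Suc k) \<le> q * (q ^ k * (a 0 - r / (1 - q)) + r / (1 - q)) + r"
    using assms(1)[of k] mult_left_mono[OF Suc q(1)] by linarith
  also have "\<dots> = q ^ Suc k * (a 0 - r / (1 - q)) + (q * (r / (1 - q)) + r)"
    by (simp add: algebra_simps)
  also have "q * (r / (1 - q)) + r = r / (1 - q)"
    using q(2) by (simp add: field_simps)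
  finally show ?case .
qed simp

lemma sqrt_affine_recursion_bound:
  fixes e :: "nat \<Rightarrow> real"
  assumes rec: "\<And>k. (e (Suc k))\<^sup>2 \<le> q * (e k)\<^sup>2 + r" and q: "0 \<le> q" "q < 1"
    and "0 \<le> r" and "0 \<le> e 0"
  shows "e k \<le> sqrt q ^ k * e 0 + sqrt r / sqrt (1 - q)"
proof -
  have pow: "(sqrt q ^ k)\<^sup>2 = q ^ k"
    using q(1) by (metis mult.commute power_mult real_sqrt_pow2)
  have "(e k)\<^sup>2 \<le> q ^ k * ((e 0)\<^sup>2 - r / (1 - q)) + r / (1 - q)"
    by (rule affine_recursion_bound[where a = "\<lambda>k. (e k)\<^sup>2"]) (use assms in auto)
  also have "\<dots> \<le> q ^ k * (e 0)\<^sup>2 + r / (1 - q)"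
    using assms by (simp add: mult_left_mono)
  also have "\<dots> = (sqrt q ^ k * e 0)\<^sup>2 + (sqrt r / sqrt (1 - q))\<^sup>2"
    using assms pow by (simp add: power_mult_distrib power_divide)
  also have "\<dots> \<le> (sqrt q ^ k * e 0 + sqrt r / sqrt (1 - q))\<^sup>2"
    using assms by (simp add: power2_sum)
  finally show ?thesis
    by (rule power2_le_imp_le) (use assms in simp)
qed

text \<open>The iteration for general local objectives, which enter through a quadratic upper bound
  and a Lipschitz bound. All agents form one vector, so a step is one application of
  \<open>mix W\<close> and one stacked gradient.\<close>

locale dgd =
  fixes W :: "real^'n^'n" and lam :: "nat \<Rightarrow> real" and \<beta> L \<alpha> :: real
    and f :: "'n \<Rightarrow> 'a::euclidean_space \<Rightarrow> real" and g :: "'n \<Rightarrow> 'a \<Rightarrow> 'a"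
    and X :: "nat \<Rightarrow> 'a^'n"
  assumes sym: "transpose W = W" and ds: "doubly_stochastic W"
    and ev: "eigenvalue_list W lam" and lam1: "lam 1 = 1"
    and \<beta>: "\<beta> = max \<bar>lam 2\<bar> \<bar>lam CARD('n)\<bar>" "\<beta> < 1"
    and upper: "\<And>i u v. f i v \<le> f i u + g i u \<bullet> (v - u) + L / 2 * (norm (v - u))\<^sup>2"
    and lips: "\<And>i u v. norm (g i u - g i v) \<le> L * norm (u - v)"
    and L: "L > 0" and \<alpha>: "\<alpha> > 0" "\<alpha> * L \<le> 1 + lam CARD('n)"
    and X_0: "X 0 = 0"
    and X_Suc: "\<And>k. X (Suc k) = mix W (X k) - \<alpha> *\<^sub>R (\<chi> i. g i (X k $ i))"
begin

abbreviation grads :: "'a^'n \<Rightarrow> 'a^'n" where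
  "grads Y \<equiv> \<chi> i. g i (Y $ i)"

lemma inner_mix_ge: "lam CARD('n) * (norm Y)\<^sup>2 \<le> Y \<bullet> mix W Y" for Y :: "'a^'n"
  unfolding inner_eq_sum_coord[of Y] norm2_eq_sum_coord[of Y] sum_distrib_left coord_mix
  by (intro sum_mono symmetric_quadratic_form_ge sym ev)

lemma norm_mix_le:
  fixes Y :: "'a^'n"
  assumes "(\<Sum>i\<in>UNIV. Y $ i) = 0"
  shows "norm (mix W Y) \<le> \<beta> * norm Y"
proof -
  have W1: "W *v 1 = 1"
    using ds by (simp add: doubly_stochastic_def vec_eq_iff matrix_vector_mult_def)
  have "1 \<bullet> coord r Y = 0" for r
    using assms by (simp add: inner_vec_def coord_def flip: inner_sum_left)
  then have "norm (W *v coord r Y) \<le> \<beta> * norm (coord r Y)" for r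
    by (intro norm_mixing_le_orthogonal_one[OF sym W1 ev lam1 \<beta>])
  then have "(norm (W *v coord r Y))\<^sup>2 \<le> \<beta>\<^sup>2 * (norm (coord r Y))\<^sup>2" for r
    by (metis norm_ge_zero power_mono power_mult_distrib)
  then have "(norm (mix W Y))\<^sup>2 \<le> (\<beta> * norm Y)\<^sup>2"
    unfolding power_mult_distrib norm2_eq_sum_coord[of Y] norm2_eq_sum_coord[of "mix W Y"] coord_mix sum_distrib_left
    by (rule sum_mono)
  then show ?thesis
    by (rule power2_le_imp_le) (simp add: \<beta>(1))
qed

text \<open>The iteration is gradient descent with unit stepsize for this function.\<close>

definition potential :: "'a^'n \<Rightarrow> real" where
  "potential Y = ((norm Y)\<^sup>2 - Y \<bullet> mix W Y) / 2 + \<alpha> * (\<Sum>i\<in>UNIV. f i (Y $ i))"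

text \<open>Substituting the iteration for the gradient cancels every term that involves
  \<open>Y\<close>. The change is at most \<open>(\<alpha> * L - 1) / 2\<close> times the squared
  norm of \<open>d\<close> minus half of \<open>d \<bullet> mix W d\<close>; the least eigenvalue
  and the stepsize bound make this nonpositive.\<close>

lemma potential_decreasing: "potential (X (Suc k)) \<le> potential (X k)"
proof -
  define Y d where "Y = X k" and "d = X (Suc k) - X k"
  have G: "\<alpha> *\<^sub>R grads Y = mix W Y - Y - d" and Z: "X (Suc k) = Y + d"
    by (simp_all add: Y_def d_def X_Suc)
  have "(\<Sum>i\<in>UNIV. f i ((Y + d) $ i))
      \<le> (\<Sum>i\<in>UNIV. f i (Y $ i) + g i (Y $ i) \<bullet> (d $ i) + L / 2 * (norm (d $ i))\<^sup>2)"
  proof (rule sum_mono)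
    show "f i ((Y + d) $ i) \<le> f i (Y $ i) + g i (Y $ i) \<bullet> (d $ i) + L / 2 * (norm (d $ i))\<^sup>2" for i
      using upper[of i "(Y + d) $ i" "Y $ i"] by simp
  qed
  also have "\<dots> = (\<Sum>i\<in>UNIV. f i (Y $ i)) + grads Y \<bullet> d + L / 2 * (norm d)\<^sup>2"
    by (simp add: sum.distrib inner_vec_def norm2_vec sum_distrib_left)
  finally have "\<alpha> * (\<Sum>i\<in>UNIV. f i ((Y + d) $ i))
      \<le> \<alpha> * ((\<Sum>i\<in>UNIV. f i (Y $ i)) + grads Y \<bullet> d + L / 2 * (norm d)\<^sup>2)"
    using \<alpha>(1) by (simp only: mult_left_mono less_imp_le)
  also have "\<dots> = \<alpha> * (\<Sum>i\<in>UNIV. f i (Y $ i)) + (\<alpha> *\<^sub>R grads Y) \<bullet> d + \<alpha> * L / 2 * (norm d)\<^sup>2"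
    by (simp only: inner_scaleR_left) (simp add: algebra_simps)
  also have "\<dots> = \<alpha> * (\<Sum>i\<in>UNIV. f i (Y $ i)) + (mix W Y \<bullet> d - Y \<bullet> d - (norm d)\<^sup>2) + \<alpha> * L / 2 * (norm d)\<^sup>2"
    unfolding G by (simp only: inner_diff_left power2_norm_eq_inner)
  finally have F: "\<alpha> * (\<Sum>i\<in>UNIV. f i ((Y + d) $ i)) \<le> \<dots>" .
  have "Y \<bullet> mix W d = mix W Y \<bullet> d" "d \<bullet> mix W Y = mix W Y \<bullet> d"
    using inner_mix_commute[OF sym, of Y d] by (simp_all add: inner_commute)
  then have Q: "(norm (Y + d))\<^sup>2 - (Y + d) \<bullet> mix W (Y + d)
      = (norm Y)\<^sup>2 - Y \<bullet> mix W Y + 2 * (Y \<bullet> d - mix W Y \<bullet> d) + ((norm d)\<^sup>2 - d \<bullet> mix W d)"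
    by (simp add: mix_add power2_norm_eq_inner inner_add_left inner_add_right inner_commute[of d Y])
  have "\<alpha> * L * (norm d)\<^sup>2 \<le> (1 + lam CARD('n)) * (norm d)\<^sup>2"
    using \<alpha>(2) by (rule mult_right_mono) simp
  then show ?thesis
    using F inner_mix_ge[of d] unfolding potential_def Z Q Y_def[symmetric]
    by (simp add: field_simps)
qed

text \<open>The quadratic part of \<open>potential\<close> is nonnegative and vanishes at the
  starting point 0.\<close>

lemma sum_objectives_le: "(\<Sum>i\<in>UNIV. f i (X k $ i)) \<le> (\<Sum>i\<in>UNIV. f i 0)"
proof -
  have "potential (X k) \<le> potential (X 0)"
    by (rule lift_Suc_antimono_le[of "\<lambda>k. potential (X k)"]) (simp_all add: potential_decreasing)
  moreover have "potential (X 0) = \<alpha> * (\<Sum>i\<in>UNIV. f i 0)"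
    by (simp add: potential_def X_0)
  moreover have "\<alpha> * (\<Sum>i\<in>UNIV. f i (X k $ i)) \<le> potential (X k)"
    using inner_mix_le_norm2[OF ds, of "X k"] by (simp add: potential_def)
  ultimately show ?thesis
    using \<alpha>(1) by (metis mult_le_cancel_left_pos order_trans)
qed

text \<open>Each squared local gradient is at most \<open>2 * L\<close> times the local gap, and the
  sum of the gaps never exceeds its initial value. With the local minima as \<open>m\<close> the
  bound is \<open>D\<close>.\<close>

lemma norm_grads_le:
  assumes "\<And>i v. m i \<le> f i v"
  shows "norm (grads (X k)) \<le> sqrt (2 * L * (\<Sum>i\<in>UNIV. f i 0 - m i))"
proof (rule real_le_rsqrt)
  have "(norm (grads (X k)))\<^sup>2 = (\<Sum>i\<in>UNIV. (norm (g i (X k $ i)))\<^sup>2)"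
    by (simp add: norm2_vec)
  also have "\<dots> \<le> (\<Sum>i\<in>UNIV. 2 * L * (f i (X k $ i) - m i))"
    by (intro sum_mono norm2_grad_le upper L assms)
  also have "\<dots> \<le> 2 * L * (\<Sum>i\<in>UNIV. f i 0 - m i)"
    using sum_objectives_le[of k] L by (simp add: sum_subtractf flip: sum_distrib_left)
  finally show "(norm (grads (X k)))\<^sup>2 \<le> 2 * L * (\<Sum>i\<in>UNIV. f i 0 - m i)" .
qed

text \<open>The bound is the fixed point of the recursion that multiplies by \<beta> and adds
  \<open>\<alpha> * D\<close>; the deviation starts at 0.\<close>

lemma norm_dev_X_le:
  assumes D: "\<And>k. norm (grads (X k)) \<le> D"
  shows "norm (dev (X k)) \<le> \<alpha> * D / (1 - \<beta>)"
proof (induction k)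
  case 0
  have "0 \<le> D" using D[of 0] norm_ge_zero order_trans by blast
  moreover have "dev (X 0) = 0" by (simp add: X_0 dev_def mean_def vec_eq_iff)
  ultimately show ?case using \<alpha>(1) \<beta>(2) by simp
next
  case (Suc k)
  have "0 \<le> \<beta>" by (simp add: \<beta>(1))
  have "dev (X (Suc k)) = mix W (dev (X k)) - \<alpha> *\<^sub>R dev (grads (X k))"
    by (simp add: X_Suc dev_diff dev_scaleR dev_mix[OF ds])
  then have "norm (dev (X (Suc k))) \<le> norm (mix W (dev (X k))) + \<alpha> * norm (dev (grads (X k)))"
    using \<alpha>(1) norm_triangle_ineq4[of "mix W (dev (X k))" "\<alpha> *\<^sub>R dev (grads (X k))"] by simp
  also have "\<dots> \<le> \<beta> * (\<alpha> * D / (1 - \<beta>)) + \<alpha> * D"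
  proof (intro add_mono mult_left_mono)
    show "norm (mix W (dev (X k))) \<le> \<beta> * (\<alpha> * D / (1 - \<beta>))"
      using norm_mix_le[OF sum_dev] mult_left_mono[OF Suc \<open>0 \<le> \<beta>\<close>] by (rule order_trans)
    show "norm (dev (grads (X k))) \<le> D"
      using norm_dev_le D by (rule order_trans)
  qed (use \<alpha>(1) in simp)
  also have "\<dots> = \<alpha> * D / (1 - \<beta>)"
    using \<beta>(2) by (simp add: field_simps)
  finally show ?case .
qed

lemma norm_sub_mean_le:
  assumes "\<And>k. norm (grads (X k)) \<le> D"
  shows "norm (X k $ i - mean (X k)) \<le> \<alpha> * D / (1 - \<beta>)"
  using norm_dev_X_le[OF assms, of k] Finite_Cartesian_Product.norm_nth_le[of "dev (X k)" i]
  by (simp add: dev_def)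

lemma mean_X_Suc: "mean (X (Suc k)) = mean (X k) - \<alpha> *\<^sub>R mean (grads (X k))"
  by (simp add: X_Suc mean_diff mean_mix[OF ds] mean_scaleR)

lemma norm_mean_grads_diff_le:
  assumes "\<And>k. norm (grads (X k)) \<le> D"
  shows "norm (mean (grads (X k)) - mean (\<chi> i. g i (mean (X k)))) \<le> L * (\<alpha> * D / (1 - \<beta>))"
  unfolding mean_diff[symmetric]
proof (rule norm_mean_le)
  fix i
  have "norm (g i (X k $ i) - g i (mean (X k))) \<le> L * norm (X k $ i - mean (X k))"
    by (rule lips)
  also have "\<dots> \<le> L * (\<alpha> * D / (1 - \<beta>))"
    using norm_sub_mean_le[OF assms, of k i] L by (simp only: mult_left_mono less_imp_le)
  finally show "norm ((grads (X k) - (\<chi> i. g i (mean (X k)))) $ i) \<le> L * (\<alpha> * D / (1 - \<beta>))"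
    by simp
qed

text \<open>\<open>q\<close> is the square of \<open>c3\<close> in factored form. The recursion runs
  for the distance of the mean to \<open>S\<close>; the last summand bounds the distance of an agent
  to the mean.\<close>

theorem distance_to_minimizers:
  assumes D: "\<And>k. norm (grads (X k)) \<le> D"
    and S: "closed S" "S \<noteq> {}"
    and coer: "\<And>z. c1 * (norm (mean (\<chi> i. g i z)))\<^sup>2 + c2 * (norm (z - closest_point S z))\<^sup>2
        \<le> mean (\<chi> i. g i z) \<bullet> (z - closest_point S z)"
    and "\<alpha> \<le> c1" and "0 \<le> c2" and "0 < \<delta>"
    and q: "q = (1 + \<alpha> * \<delta>) * (1 - \<alpha> * c2)" "0 \<le> q" "q < 1"
  shows "norm (X k $ i - closest_point S (mean (X k)))
    \<le> sqrt q ^ k * norm (closest_point S 0)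
      + (sqrt (\<alpha> * (\<alpha> + inverse \<delta>) * (L * (\<alpha> * D / (1 - \<beta>)))\<^sup>2) / sqrt (1 - q) + \<alpha> * D / (1 - \<beta>))"
proof -
  define e where "e k = norm (mean (X k) - closest_point S (mean (X k)))" for k
  let ?r = "\<alpha> * (\<alpha> + inverse \<delta>) * (L * (\<alpha> * D / (1 - \<beta>)))\<^sup>2"
  have "(e (Suc k))\<^sup>2 \<le> q * (e k)\<^sup>2 + ?r" for k
  proof -
    let ?z = "mean (X k)"
    \<comment> \<open>The old projection is a point of \<open>S\<close>, so the new distance to
      \<open>S\<close> is at most the distance to that point.\<close>
    have "e (Suc k) \<le> norm (?z - closest_point S ?z - \<alpha> *\<^sub>R mean (grads (X k)))"
      using closest_point_le[OF S(1) closest_point_in_set[OF S, of ?z], of "mean (X (Suc k))"]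
      by (simp add: e_def mean_X_Suc dist_norm algebra_simps)
    then have "(e (Suc k))\<^sup>2 \<le> (norm (?z - closest_point S ?z - \<alpha> *\<^sub>R mean (grads (X k))))\<^sup>2"
      by (rule power_mono) (simp add: e_def)
    also have "\<dots> \<le> q * (e k)\<^sup>2 + ?r"
      unfolding q(1) e_def using \<alpha>(1) assms(5-7)
      by (intro perturbed_gradient_step[OF coer] norm_mean_grads_diff_le D) auto
    finally show ?thesis .
  qed
  then have "e k \<le> sqrt q ^ k * e 0 + sqrt ?r / sqrt (1 - q)"
    by (rule sqrt_affine_recursion_bound) (use q \<alpha>(1) \<open>0 < \<delta>\<close> in \<open>auto simp: e_def\<close>)
  moreover have "e 0 = norm (closest_point S 0)"
    by (simp add: e_def X_0 mean_def)
  moreover have "norm (X k $ i - closest_point S (mean (X k))) \<le> norm (X k $ i - mean (X k)) + e k"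
    unfolding e_def using norm_triangle_ineq[of "X k $ i - mean (X k)" "mean (X k) - closest_point S (mean (X k))"] by simp
  ultimately show ?thesis
    using norm_sub_mean_le[OF D, of k i] by simp
qed

end

section \<open>The dual and the primal problem\<close>

lemma minimizers_iff: "x \<in> minimizers f \<longleftrightarrow> (\<forall>y. f x \<le> f y)" for f :: "'a \<Rightarrow> real"
  by (simp add: minimizers_def is_arg_min_linorder)

lemma closed_minimizers:
  fixes f :: "'a::topological_space \<Rightarrow> real"
  assumes "continuous_on UNIV f"
  shows "closed (minimizers f)"
proof -
  have "minimizers f = {x. \<forall>y. f x \<le> f y}" by (auto simp: minimizers_iff)
  then show ?thesis using assms by (auto intro!: closed_Collect_all closed_Collect_le continuous_intros)
qed

text \<open>Cauchy-Schwarz applied to \<open>norm (d i) \<le> sqrt (L i) * sqrt (a i)\<close>. The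
  constants add up, which later yields the average constant \<open>Lbar\<close> instead of the
  maximum \<open>Lh\<close>.\<close>

lemma norm2_sum_le_weighted:
  fixes d :: "'i \<Rightarrow> 'a::real_normed_vector"
  assumes "\<And>i. i \<in> I \<Longrightarrow> (norm (d i))\<^sup>2 \<le> L i * a i"
    and "\<And>i. i \<in> I \<Longrightarrow> 0 \<le> L i" and "\<And>i. i \<in> I \<Longrightarrow> 0 \<le> a i"
  shows "(norm (\<Sum>i\<in>I. d i))\<^sup>2 \<le> (\<Sum>i\<in>I. L i) * (\<Sum>i\<in>I. a i)"
proof -
  have "norm (\<Sum>i\<in>I. d i) \<le> (\<Sum>i\<in>I. \<bar>sqrt (L i)\<bar> * \<bar>sqrt (a i)\<bar>)"
    using assms by (intro sum_norm_le) (simp add: real_le_rsqrt flip: real_sqrt_mult)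
  also have "\<dots> \<le> L2_set (\<lambda>i. sqrt (L i)) I * L2_set (\<lambda>i. sqrt (a i)) I"
    by (rule L2_set_mult_ineq)
  also have "\<dots> = sqrt (\<Sum>i\<in>I. L i) * sqrt (\<Sum>i\<in>I. a i)"
    using assms(2,3) by (simp add: L2_set_def cong: sum.cong)
  finally have "(norm (\<Sum>i\<in>I. d i))\<^sup>2 \<le> (sqrt (\<Sum>i\<in>I. L i) * sqrt (\<Sum>i\<in>I. a i))\<^sup>2"
    by (rule power_mono) simp
  then show ?thesis
    using assms(2,3) by (simp add: power_mult_distrib sum_nonneg)
qed

section \<open>The dual objective and its gradient\<close>

definition dual_grad ::
  "real \<Rightarrow> ('q \<Rightarrow> 'n::finite) \<Rightarrow> real^'q^'p \<Rightarrow> real^'p \<Rightarrow> real^'p \<Rightarrow> real^'p" where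
  "dual_grad \<gamma> own A b x = (\<Sum>i\<in>UNIV. local_grad \<gamma> own A b i x)"

lemma dual_obj_lower:
  assumes "\<gamma> \<ge> 0"
  shows "dual_obj \<gamma> own A b u + dual_grad \<gamma> own A b u \<bullet> (v - u) \<le> dual_obj \<gamma> own A b v"
  unfolding dual_obj_def dual_grad_def inner_sum_left sum.distrib[symmetric]
  by (intro sum_mono local_obj_lower assms)

lemma dual_obj_upper:
  assumes "\<gamma> \<ge> 0"
  shows "dual_obj \<gamma> own A b v \<le> dual_obj \<gamma> own A b u + dual_grad \<gamma> own A b u \<bullet> (v - u)
    + (\<Sum>i\<in>UNIV. \<gamma> * (spectral_norm (block own A i))\<^sup>2) / 2 * (norm (v - u))\<^sup>2"
  unfolding dual_obj_def dual_grad_def inner_sum_left sum_divide_distrib sum_distrib_right sum.distrib[symmetric]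
  by (intro sum_mono local_obj_upper assms order_refl)

lemma gderiv_dual_obj:
  assumes "\<gamma> \<ge> 0"
  shows "GDERIV (dual_obj \<gamma> own A b) x :> dual_grad \<gamma> own A b x"
  by (rule gderiv_if_quadratic_sandwich[OF dual_obj_lower dual_obj_upper]) (rule assms)+

lemma dual_grad_minimizer:
  assumes "\<gamma> \<ge> 0" "x \<in> minimizers (dual_obj \<gamma> own A b)"
  shows "dual_grad \<gamma> own A b x = 0"
proof -
  let ?K = "(\<Sum>i\<in>UNIV. \<gamma> * (spectral_norm (block own A i))\<^sup>2)"
  have "0 \<le> ?K" using assms(1) by (simp add: sum_nonneg)
  \<comment> \<open>The \<open>+ 1\<close> makes the smoothness constant positive even when all
    blocks vanish; the value at \<open>x\<close> itself is the lower bound.\<close>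
  have "(norm (dual_grad \<gamma> own A b x))\<^sup>2 \<le> 2 * (?K + 1) * (dual_obj \<gamma> own A b x - dual_obj \<gamma> own A b x)"
  proof (rule norm2_grad_le)
    fix y
    have "dual_obj \<gamma> own A b y \<le> dual_obj \<gamma> own A b x + dual_grad \<gamma> own A b x \<bullet> (y - x) + ?K / 2 * (norm (y - x))\<^sup>2"
      by (rule dual_obj_upper[OF assms(1)])
    also have "?K / 2 * (norm (y - x))\<^sup>2 \<le> (?K + 1) / 2 * (norm (y - x))\<^sup>2"
      by (rule mult_right_mono) simp_all
    finally show "dual_obj \<gamma> own A b y \<le> dual_obj \<gamma> own A b x + dual_grad \<gamma> own A b x \<bullet> (y - x) + (?K + 1) / 2 * (norm (y - x))\<^sup>2"
      by simp
  qed (use assms(2) \<open>0 \<le> ?K\<close> in \<open>auto simp: minimizers_iff\<close>)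
  then show ?thesis by simp
qed

lemma closed_minimizers_dual_obj:
  assumes "\<gamma> \<ge> 0"
  shows "closed (minimizers (dual_obj \<gamma> own A b))"
proof (rule closed_minimizers)
  show "continuous_on UNIV (dual_obj \<gamma> own A b)"
    using gderiv_dual_obj[OF assms] unfolding gderiv_def
    by (blast intro: continuous_at_imp_continuous_on has_derivative_continuous)
qed

lemma dual_grad_cocoercive:
  assumes "\<gamma> \<ge> 0"
  shows "(norm (dual_grad \<gamma> own A b u - dual_grad \<gamma> own A b v))\<^sup>2
    \<le> (\<Sum>i\<in>UNIV. \<gamma> * (spectral_norm (block own A i))\<^sup>2) *
      ((dual_grad \<gamma> own A b u - dual_grad \<gamma> own A b v) \<bullet> (u - v))"
  unfolding dual_grad_def sum_subtractf[symmetric] inner_sum_left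
proof (rule norm2_sum_le_weighted)
  fix i
  let ?d = "local_grad \<gamma> own A b i u - local_grad \<gamma> own A b i v"
  let ?L = "\<gamma> * (spectral_norm (block own A i))\<^sup>2"
  show co: "(norm ?d)\<^sup>2 \<le> ?L * (?d \<bullet> (u - v))" by (rule local_grad_cocoercive[OF assms])
  show L: "0 \<le> ?L" using assms by simp
  \<comment> \<open>A zero constant forces \<open>?d = 0\<close>; a positive one can be divided out
    of the cocoercivity bound.\<close>
  show "0 \<le> ?d \<bullet> (u - v)"
  proof (cases "?L = 0")
    case True
    then have "?d = 0" using co by (simp only: mult_zero_left power2_less_eq_zero_iff norm_eq_zero)
    then show ?thesis by simp
  next
    case False
    then have "0 < ?L" using L by linarith
    moreover have "0 \<le> ?L * (?d \<bullet> (u - v))" using co by (rule order_trans[OF zero_le_power2])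
    ultimately show ?thesis by (simp only: zero_le_mult_iff) linarith
  qed
qed

lemma shrink_0 [simp]: "shrink 0 = 0"
  by (simp add: vec_eq_iff shrink_nth)

text \<open>If every point is a minimizer, the objective is constantly its value 0 at the origin.
  Adding the values at \<open>z\<close> and \<open>- z\<close> removes the linear term and leaves a
  vanishing sum of squares, so \<open>shrink\<close> vanishes on the range of the transposed block,
  which rescaling shows to be trivial.\<close>

lemma spectral_norm_block_eq_0:
  fixes own :: "'q::finite \<Rightarrow> 'n::finite"
  assumes "\<gamma> > 0" and all: "minimizers (dual_obj \<gamma> own A b) = UNIV"
  shows "spectral_norm (block own A i) = 0"
proof -
  let ?B = "block own A i"
  let ?s = "\<lambda>i z. shrink (transpose (block own A i) *v z)"
  have const: "dual_obj \<gamma> own A b z = 0" for z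
  proof -
    have "dual_obj \<gamma> own A b z = dual_obj \<gamma> own A b 0"
      using all by (metis UNIV_I minimizers_iff order_antisym)
    then show ?thesis by (simp add: dual_obj_def local_obj_eq)
  qed
  have shrink0: "?s i z = 0" for z
  proof -
    have "dual_obj \<gamma> own A b z + dual_obj \<gamma> own A b (- z)
        = (\<Sum>j\<in>UNIV. \<gamma> * ((norm (?s j z))\<^sup>2 / 2) + \<gamma> * ((norm (?s j (- z)))\<^sup>2 / 2))"
      by (simp only: dual_obj_def local_obj_eq flip: sum.distrib) (rule sum.cong, simp_all)
    then have "(\<Sum>j\<in>UNIV. \<gamma> * ((norm (?s j z))\<^sup>2 / 2) + \<gamma> * ((norm (?s j (- z)))\<^sup>2 / 2)) = 0"
      by (simp only: const)
    then have "\<gamma> * ((norm (?s i z))\<^sup>2 / 2) + \<gamma> * ((norm (?s i (- z)))\<^sup>2 / 2) = 0"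
      using \<open>\<gamma> > 0\<close> by (subst (asm) sum_nonneg_eq_0_iff) auto
    moreover have "0 \<le> \<gamma> * ((norm (?s i z))\<^sup>2 / 2)" "0 \<le> \<gamma> * ((norm (?s i (- z)))\<^sup>2 / 2)"
      using \<open>\<gamma> > 0\<close> by auto
    ultimately have "\<gamma> * ((norm (?s i z))\<^sup>2 / 2) = 0" by linarith
    then show ?thesis using \<open>\<gamma> > 0\<close> by (simp only: mult_eq_0_iff) simp
  qed
  have "transpose ?B *v z = 0" for z
  proof (rule ccontr)
    assume "transpose ?B *v z \<noteq> 0"
    then obtain c where c: "(transpose ?B *v z) $ c \<noteq> 0" by (metis vec_eq_iff zero_index)
    define t where "t = 2 / (transpose ?B *v z) $ c"
    have "(transpose ?B *v (t *\<^sub>R z)) $ c = 2"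
      using c by (simp add: t_def matrix_vector_mult_scaleR del: transpose_matrix_vector)
    then have "?s i (t *\<^sub>R z) $ c = 1" by (simp only: shrink_nth)
    then show False by (simp only: shrink0) simp
  qed
  then have "(?B *v y) \<bullet> (?B *v y) = 0" for y
    by (simp only: inner_matrix_vector_mult_left) simp
  then have "(*v) ?B = (\<lambda>_. 0)" by auto
  then show ?thesis by (simp only: onorm_zero)
qed

section \<open>From the blocks to the full matrix, and from dual to primal\<close>

lemma transpose_block_nth:
  "(transpose (block own A i) *v z) $ c = (if own c = i then (transpose A *v z) $ c else 0)"
  unfolding matrix_vector_mult_def transpose_def block_def by simp

lemma sum_block_mult_shrink:
  fixes own :: "'q::finite \<Rightarrow> 'n::finite" and A :: "real^'q^'p"
  shows "(\<Sum>i\<in>UNIV. block own A i *v shrink (transpose (block own A i) *v z)) = A *v shrink (transpose A *v z)"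
proof -
  have "(block own A i *v shrink (transpose (block own A i) *v z)) $ r
      = (\<Sum>c\<in>UNIV. if own c = i then A $ r $ c * shrink (transpose A *v z) $ c else 0)" for i r
    unfolding matrix_vector_mult_def[of "block own A i"]
    by (simp add: block_def shrink_nth transpose_block_nth[unfolded block_def] if_distrib if_distribR del: transpose_matrix_vector cong: if_cong)
  then have "(\<Sum>i\<in>UNIV. block own A i *v shrink (transpose (block own A i) *v z)) $ r
      = (\<Sum>c\<in>UNIV. \<Sum>i\<in>UNIV. if own c = i then A $ r $ c * shrink (transpose A *v z) $ c else 0)" for r
    by (simp only: sum_component) (rule sum.swap)
  moreover have "(A *v w) $ r = (\<Sum>c\<in>UNIV. A $ r $ c * w $ c)" for w r
    by (simp add: matrix_vector_mult_def)
  ultimately show ?thesis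
    by (simp only: vec_eq_iff sum.delta' finite_class.finite_UNIV UNIV_I if_True simp_thms)
qed

lemma dual_grad_eq:
  fixes own :: "'q::finite \<Rightarrow> 'n::finite"
  shows "dual_grad \<gamma> own A b z = \<gamma> *\<^sub>R (A *v shrink (transpose A *v z)) - b"
proof -
  have "dual_grad \<gamma> own A b z
      = \<gamma> *\<^sub>R (\<Sum>i\<in>UNIV. block own A i *v shrink (transpose (block own A i) *v z)) - (\<Sum>i\<in>(UNIV :: 'n set). (1 / real CARD('n)) *\<^sub>R b)"
    by (simp only: dual_grad_def local_grad_def sum_subtractf scaleR_sum_right)
  then show ?thesis by (simp only: sum_block_mult_shrink sum_constant_scaleR) simp
qed

text \<open>Split \<open>z = s + p\<close>: the clipped part \<open>p\<close> is a subgradient of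
  the absolute value at \<open>\<gamma> * s\<close>, and \<open>s\<close> is the derivative there of
  the quadratic part, whose second-order remainder is the last square on the left.\<close>

lemma elastic_abs_lower:
  fixes y z \<gamma> :: real
  assumes "\<gamma> > 0"
  defines "s \<equiv> z - max (-1) (min 1 z)"
  shows "\<bar>\<gamma> * s\<bar> + 1 / (2 * \<gamma>) * (\<gamma> * s)\<^sup>2 + z * (y - \<gamma> * s) + 1 / (2 * \<gamma>) * (y - \<gamma> * s)\<^sup>2
    \<le> \<bar>y\<bar> + 1 / (2 * \<gamma>) * y\<^sup>2"
proof -
  define p where "p = max (-1) (min 1 z)"
  have z: "z = s + p" by (simp add: s_def p_def)
  have "p * s = \<bar>s\<bar>" by (auto simp: p_def s_def max_def min_def)
  then have "p * (\<gamma> * s) = \<bar>\<gamma> * s\<bar>"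
    using assms(1) by (simp add: abs_mult mult.left_commute)
  moreover have "p * y \<le> \<bar>y\<bar>"
    using clip_abs_le_1[of z] mult_right_mono[of "\<bar>p\<bar>" 1 "\<bar>y\<bar>"] abs_ge_self[of "p * y"]
    by (simp add: p_def abs_mult)
  moreover have "1 / (2 * \<gamma>) * y\<^sup>2 = 1 / (2 * \<gamma>) * (\<gamma> * s)\<^sup>2 + s * (y - \<gamma> * s) + 1 / (2 * \<gamma>) * (y - \<gamma> * s)\<^sup>2"
    using assms(1) by (simp add: field_simps power2_eq_square)
  ultimately show ?thesis unfolding z by (simp add: algebra_simps)
qed

lemma primal_obj_lower:
  assumes "\<gamma> > 0"
  shows "primal_obj \<gamma> (\<gamma> *\<^sub>R shrink z) + z \<bullet> (y - \<gamma> *\<^sub>R shrink z) + 1 / (2 * \<gamma>) * (norm (y - \<gamma> *\<^sub>R shrink z))\<^sup>2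
    \<le> primal_obj \<gamma> y"
proof -
  have n: "(norm v)\<^sup>2 = (\<Sum>c\<in>UNIV. (v $ c)\<^sup>2)" for v :: "real^'a"
    by (simp add: norm2_vec)
  show ?thesis
    unfolding primal_obj_def n inner_vec_def sum_distrib_left sum.distrib[symmetric]
    by (rule sum_mono) (use elastic_abs_lower[OF assms] in \<open>simp add: shrink_nth\<close>)
qed

text \<open>Differences of feasible points lie in the kernel of \<open>A\<close>, orthogonal to
  \<open>transpose A *v xs\<close>, so the linear term of \<open>primal_obj_lower\<close> drops out.
  Since \<open>xs\<close> is any dual minimizer, a different one may be used for each
  iterate.\<close>

lemma primal_solution_iff:
  fixes own :: "'q::finite \<Rightarrow> 'n::finite"
  assumes "\<gamma> > 0" and "xs \<in> minimizers (dual_obj \<gamma> own A b)"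
  shows "primal_solution \<gamma> A b y \<longleftrightarrow> y = \<gamma> *\<^sub>R shrink (transpose A *v xs)"
proof -
  let ?y = "\<gamma> *\<^sub>R shrink (transpose A *v xs)"
  have feas: "A *v ?y = b"
    using dual_grad_minimizer[OF less_imp_le[OF assms(1)] assms(2)]
    by (simp only: dual_grad_eq matrix_vector_mult_scaleR) simp
  have lower: "primal_obj \<gamma> ?y + 1 / (2 * \<gamma>) * (norm (y - ?y))\<^sup>2 \<le> primal_obj \<gamma> y" if "A *v y = b" for y
  proof -
    have "(transpose A *v xs) \<bullet> (y - ?y) = 0"
      using inner_matrix_vector_mult_left[of A "y - ?y" xs] feas that
      by (simp add: inner_commute matrix_vector_mult_diff_distrib del: transpose_matrix_vector)
    then show ?thesis using primal_obj_lower[OF assms(1), of "transpose A *v xs" y] by simp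
  qed
  have nonneg: "0 \<le> 1 / (2 * \<gamma>) * (norm (y - ?y))\<^sup>2" for y using assms(1) by simp
  show ?thesis
  proof
    assume "primal_solution \<gamma> A b y"
    then have "A *v y = b" "primal_obj \<gamma> y \<le> primal_obj \<gamma> ?y"
      using feas unfolding primal_solution_def is_arg_min_linorder by blast+
    then have "1 / (2 * \<gamma>) * (norm (y - ?y))\<^sup>2 \<le> 0" using lower by fastforce
    then show "y = ?y" using assms(1) by (simp add: divide_le_0_iff)
  next
    assume "y = ?y"
    moreover have "primal_obj \<gamma> ?y \<le> primal_obj \<gamma> z" if "A *v z = b" for z
      using lower[OF that] nonneg[of z] by linarith
    ultimately show "primal_solution \<gamma> A b y"
      using feas unfolding primal_solution_def is_arg_min_linorder by blast
  qed
qed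

text \<open>The blocks have disjoint supports, so the stacked difference is the sum of the padded
  local ones; the triangle inequality over the agents gives the factor
  \<open>CARD('n)\<close>.\<close>

lemma norm_stacked_primal_diff_le:
  fixes own :: "'q::finite \<Rightarrow> 'n::finite"
  assumes "\<gamma> > 0"
  shows "norm (stacked_primal \<gamma> own A x k - \<gamma> *\<^sub>R shrink (transpose A *v z))
    \<le> real CARD('n) * \<gamma> * (MAX i. spectral_norm (block own A i) * norm (x k i - z))"
proof -
  let ?T = "\<lambda>i. transpose (block own A i)"
  let ?d = "\<lambda>i. \<gamma> *\<^sub>R (shrink (?T i *v x k i) - shrink (?T i *v z))"
  let ?M = "MAX i. spectral_norm (block own A i) * norm (x k i - z)"
  have "stacked_primal \<gamma> own A x k - \<gamma> *\<^sub>R shrink (transpose A *v z) = (\<Sum>i\<in>UNIV. ?d i)"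
  proof (rule vec_eq_iff[THEN iffD2], rule allI)
    fix c
    have "(\<Sum>i\<in>UNIV. ?d i) $ c = (\<Sum>i\<in>UNIV. if own c = i then
        \<gamma> * (shrink (?T i *v x k i) $ c - shrink (?T i *v z) $ c) else 0)"
      unfolding sum_component
      by (rule sum.cong) (simp_all add: shrink_nth transpose_block_nth del: transpose_matrix_vector)
    also have "\<dots> = \<gamma> * (shrink (?T (own c) *v x k (own c)) $ c - shrink (?T (own c) *v z) $ c)"
      by (simp only: sum.delta' finite_class.finite_UNIV UNIV_I if_True)
    also have "\<dots> = (stacked_primal \<gamma> own A x k - \<gamma> *\<^sub>R shrink (transpose A *v z)) $ c"
      by (simp add: stacked_primal_def local_primal_def shrink_nth transpose_block_nth right_diff_distrib
          del: transpose_matrix_vector)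
    finally show "(stacked_primal \<gamma> own A x k - \<gamma> *\<^sub>R shrink (transpose A *v z)) $ c = (\<Sum>i\<in>UNIV. ?d i) $ c" ..
  qed
  also have "norm \<dots> \<le> (\<Sum>i\<in>(UNIV :: 'n set). \<gamma> * ?M)"
  proof (rule sum_norm_le)
    fix i
    have "norm (?d i) \<le> \<gamma> * norm (?T i *v x k i - ?T i *v z)"
      using assms norm_shrink_diff_le[of "?T i *v x k i" "?T i *v z"]
      by (simp del: transpose_matrix_vector)
    also have "\<dots> \<le> \<gamma> * (spectral_norm (block own A i) * norm (x k i - z))"
      using assms norm_transpose_mult_le[of "block own A i" "x k i - z"]
      by (simp only: matrix_vector_mult_diff_distrib mult_left_mono less_imp_le)
    also have "\<dots> \<le> \<gamma> * ?M"
      using assms by (intro mult_left_mono Max_ge) auto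
    finally show "norm (?d i) \<le> \<gamma> * ?M" .
  qed
  finally show ?thesis by (simp add: mult.assoc)
qed

section \<open>The optimized \<delta> and the order of the error floor\<close>

lemma c3_delta_opt:
  assumes "\<alpha> * c2 < 1"
  shows "c3 c2 \<alpha> (delta_opt c2 \<alpha>) = sqrt (1 - \<alpha> * c2 / 2)"
proof -
  have "1 - \<alpha> * c2 + \<alpha> * delta_opt c2 \<alpha> - \<alpha>\<^sup>2 * delta_opt c2 \<alpha> * c2
      = (1 - \<alpha> * c2) + \<alpha> * (delta_opt c2 \<alpha> * (1 - \<alpha> * c2))"
    by (simp add: algebra_simps power2_eq_square)
  \<comment> \<open>The equation behind the choice of \<open>delta_opt\<close>: exactly half of the
    contraction \<open>\<alpha> * c2\<close> is given back.\<close>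
  also have "delta_opt c2 \<alpha> * (1 - \<alpha> * c2) = c2 / 2"
  proof -
    have "c2 / (2 * d) * d = c2 / 2" if "d \<noteq> 0" for d using that by simp
    then show ?thesis unfolding delta_opt_def using assms by (metis diff_gt_0_iff_gt less_irrefl)
  qed
  finally show ?thesis by (simp add: c3_def)
qed

text \<open>The filter is principal, so the bound is uniform over all stepsizes below
  \<open>c1\<close> and all \<beta>' in [0, 1), with the other constants fixed. As
  \<open>1 - c3^2 = a * c2 / 2\<close>, one factor \<open>a\<close> cancels under the root and the
  square of \<open>a / (1 - \<beta>')\<close> remains; \<open>2 / c2\<close> bounds the inverse of
  \<open>delta_opt c2 a\<close>.\<close>

lemma error_floor_bigo:
  fixes c1 c2 Lh D :: real
  assumes "0 < c1" "0 < c2" and c12: "c1 * c2 \<le> 1"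
  shows "(\<lambda>(a, \<beta>'). error_floor Lh D c2 \<beta>' a (delta_opt c2 a))
    \<in> O[principal ({0<..<c1} \<times> {0..<1})](\<lambda>(a, \<beta>'). a / (1 - \<beta>'))"
proof (rule bigoI)
  define K where "K = (c1 + 2 / c2) * (2 / c2) * (Lh * D)\<^sup>2"
  have "\<bar>error_floor Lh D c2 \<beta>' a (delta_opt c2 a)\<bar> \<le> (sqrt K + \<bar>D\<bar>) * \<bar>a / (1 - \<beta>')\<bar>"
    if a: "0 < a" "a < c1" and \<beta>': "0 \<le> \<beta>'" "\<beta>' < 1" for a \<beta>'
  proof -
    have "a * c2 < c1 * c2" using a(2) \<open>0 < c2\<close> by (rule mult_strict_right_mono)
    then have ac: "0 < a * c2" "a * c2 < 1" using mult_pos_pos[OF a(1) \<open>0 < c2\<close>] c12 by linarith+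
    have inv: "inverse (delta_opt c2 a) = 2 * (1 - a * c2) / c2"
      by (simp add: delta_opt_def)
    have "inverse (delta_opt c2 a) \<le> 2 / c2"
      unfolding inv using ac \<open>0 < c2\<close> by (intro divide_right_mono) auto
    moreover have "0 \<le> inverse (delta_opt c2 a)"
      unfolding inv using ac \<open>0 < c2\<close> by simp
    ultimately have s: "0 \<le> a + inverse (delta_opt c2 a)" "a + inverse (delta_opt c2 a) \<le> c1 + 2 / c2"
      using a by auto
    have c3: "1 - (c3 c2 a (delta_opt c2 a))\<^sup>2 = a * c2 / 2"
      using ac by (simp add: c3_delta_opt)
    have "c4 Lh D \<beta>' a (delta_opt c2 a) / sqrt (a * c2 / 2)
        = sqrt (a ^ 3 * (a + inverse (delta_opt c2 a)) * (Lh\<^sup>2 * D\<^sup>2 / (1 - \<beta>')\<^sup>2) / (a * c2 / 2))"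
      by (simp only: c4_def real_sqrt_divide)
    also have "a ^ 3 * (a + inverse (delta_opt c2 a)) * (Lh\<^sup>2 * D\<^sup>2 / (1 - \<beta>')\<^sup>2) / (a * c2 / 2)
        = (a + inverse (delta_opt c2 a)) * (2 / c2 * (Lh * D)\<^sup>2 * (a / (1 - \<beta>'))\<^sup>2)"
      using a(1) \<open>0 < c2\<close> by (simp add: power2_eq_square power3_eq_cube mult_ac)
    also have "sqrt \<dots> \<le> sqrt ((c1 + 2 / c2) * (2 / c2 * (Lh * D)\<^sup>2 * (a / (1 - \<beta>'))\<^sup>2))"
      using s \<open>0 < c2\<close> by (intro real_sqrt_le_mono mult_right_mono) auto
    also have "\<dots> = sqrt (K * (a / (1 - \<beta>'))\<^sup>2)"
      by (simp only: K_def mult.assoc)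
    also have "\<dots> = sqrt K * \<bar>a / (1 - \<beta>')\<bar>"
      by (simp only: real_sqrt_mult real_sqrt_abs)
    finally have "c4 Lh D \<beta>' a (delta_opt c2 a) / sqrt (a * c2 / 2) \<le> sqrt K * \<bar>a / (1 - \<beta>')\<bar>" .
    moreover have "0 \<le> c4 Lh D \<beta>' a (delta_opt c2 a) / sqrt (a * c2 / 2)"
      unfolding c4_def using a s ac \<open>0 < c2\<close> by (intro divide_nonneg_nonneg real_sqrt_ge_zero mult_nonneg_nonneg) auto
    moreover have "\<bar>a * D / (1 - \<beta>')\<bar> = \<bar>D\<bar> * \<bar>a / (1 - \<beta>')\<bar>"
      by (simp add: abs_mult)
    ultimately show ?thesis
      unfolding error_floor_def c3 distrib_right by linarith
  qed
  then show "\<forall>\<^sub>F z in principal ({0<..<c1} \<times> {0..<1}).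
      norm (case z of (a, \<beta>') \<Rightarrow> error_floor Lh D c2 \<beta>' a (delta_opt c2 a))
        \<le> (sqrt K + \<bar>D\<bar>) * norm (case z of (a, \<beta>') \<Rightarrow> a / (1 - \<beta>'))"
    by (auto simp: eventually_principal)
qed

lemma arg_min_le_if_minimizers:
  fixes f :: "'a \<Rightarrow> real"
  assumes "minimizers f \<noteq> {}"
  shows "f (arg_min f (\<lambda>_. True)) \<le> f v"
proof -
  obtain z where "is_arg_min f (\<lambda>_. True) z" using assms by (auto simp: minimizers_def)
  then have "is_arg_min f (\<lambda>_. True) (arg_min f (\<lambda>_. True))"
    unfolding arg_min_def by (rule someI)
  then show ?thesis by (simp add: is_arg_min_linorder)
qed

section \<open>Coercivity of the averaged dual gradient\<close>

lemma mean_local_grad: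
  fixes own :: "'q::finite \<Rightarrow> 'n::finite"
  shows "mean (\<chi> i. local_grad \<gamma> own A b i z) = (1 / real CARD('n)) *\<^sub>R dual_grad \<gamma> own A b z"
  by (simp add: mean_def dual_grad_def)

text \<open>The dual gradient vanishes at the projection. The sum over the agents has cocoercivity
  constant \<open>CARD('n) * Lbar\<close>; passing to the mean divides by \<open>CARD('n)\<close>
  and leaves \<open>Lbar\<close>.\<close>

lemma
  fixes own :: "'q::finite \<Rightarrow> 'n::finite" and A :: "real^'q^'p" and b :: "real^'p" and \<gamma> \<nu> :: real
  defines "Lbar \<equiv> \<gamma> / real CARD('n) * (\<Sum>i\<in>UNIV. (spectral_norm (block own A i))\<^sup>2)"
    and "S \<equiv> minimizers (dual_obj \<gamma> own A b)"
    and "g \<equiv> \<lambda>z. mean (\<chi> i. local_grad \<gamma> own A b i z)"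
  assumes "\<gamma> > 0" and "S \<noteq> {}" and "restricted_strongly_convex (dual_obj \<gamma> own A b) \<nu>"
  shows dual_grad_restricted_cocoercive:
      "(norm (g z))\<^sup>2 \<le> Lbar * (g z \<bullet> (z - closest_point S z))"
    and dual_grad_restricted_strongly_monotone:
      "\<nu> / real CARD('n) * (norm (z - closest_point S z))\<^sup>2 \<le> g z \<bullet> (z - closest_point S z)"
proof -
  let ?n = "real CARD('n)" and ?p = "closest_point S z"
  have \<gamma>: "\<gamma> \<ge> 0" using assms by simp
  have "?p \<in> S"
    unfolding S_def using assms closed_minimizers_dual_obj[OF \<gamma>] by (intro closest_point_in_set) (auto simp: S_def)
  then have p0: "dual_grad \<gamma> own A b ?p = 0"
    unfolding S_def by (rule dual_grad_minimizer[OF \<gamma>])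
  have n: "0 < ?n" by simp
  have g: "g z = (1 / ?n) *\<^sub>R dual_grad \<gamma> own A b z"
    unfolding g_def by (rule mean_local_grad)
  have "(norm (dual_grad \<gamma> own A b z))\<^sup>2 \<le> ?n * Lbar * (dual_grad \<gamma> own A b z \<bullet> (z - ?p))"
    using dual_grad_cocoercive[OF \<gamma>, of own A b z ?p] p0
    by (simp add: Lbar_def sum_distrib_left)
  then have "(norm (dual_grad \<gamma> own A b z))\<^sup>2 / ?n\<^sup>2 \<le> ?n * Lbar * (dual_grad \<gamma> own A b z \<bullet> (z - ?p)) / ?n\<^sup>2"
    by (rule divide_right_mono) simp
  then show "(norm (g z))\<^sup>2 \<le> Lbar * (g z \<bullet> (z - ?p))"
    using n by (simp add: g power_divide power2_eq_square)
  have "\<nu> * (norm (z - ?p))\<^sup>2 \<le> dual_grad \<gamma> own A b z \<bullet> (z - ?p)"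
    using assms(6)[unfolded restricted_strongly_convex_def, rule_format, of z] p0
    by (simp add: Let_def S_def gradient_eqI[OF gderiv_dual_obj[OF \<gamma>]])
  then have "\<nu> * (norm (z - ?p))\<^sup>2 / ?n \<le> dual_grad \<gamma> own A b z \<bullet> (z - ?p) / ?n"
    by (rule divide_right_mono) simp
  then show "\<nu> / ?n * (norm (z - ?p))\<^sup>2 \<le> g z \<bullet> (z - ?p)"
    by (simp add: g)
qed

text \<open>At a non-minimizer, strong monotonicity bounds the inner product from below and
  cocoercivity with Cauchy-Schwarz from above, and the distance cancels; a positive
  \<open>Lbar\<close> provides such a point. This is what gives
  \<open>c1 * c2 \<le> 1\<close>.\<close>

lemma restricted_modulus_le:
  fixes own :: "'q::finite \<Rightarrow> 'n::finite" and A :: "real^'q^'p" and b :: "real^'p" and \<gamma> \<nu> :: real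
  defines "Lbar \<equiv> \<gamma> / real CARD('n) * (\<Sum>i\<in>UNIV. (spectral_norm (block own A i))\<^sup>2)"
    and "S \<equiv> minimizers (dual_obj \<gamma> own A b)"
  assumes "\<gamma> > 0" and "S \<noteq> {}" and "restricted_strongly_convex (dual_obj \<gamma> own A b) \<nu>"
    and "Lbar > 0"
  shows "\<nu> / real CARD('n) \<le> Lbar"
proof -
  have "S \<noteq> UNIV"
    using spectral_norm_block_eq_0[OF assms(3), of own A b] assms(6)
    by (auto simp: S_def Lbar_def)
  then obtain z where z: "z \<notin> S" by blast
  let ?e = "z - closest_point S z" and ?g = "mean (\<chi> i. local_grad \<gamma> own A b i z)"
  have "closest_point S z \<in> S"
    unfolding S_def using assms(3,4) by (intro closest_point_in_set closed_minimizers_dual_obj) (auto simp: S_def)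
  with z have e: "0 < norm ?e" by auto
  have co: "(norm ?g)\<^sup>2 \<le> Lbar * (?g \<bullet> ?e)"
    unfolding Lbar_def S_def by (rule dual_grad_restricted_cocoercive[OF assms(3) _ assms(5)]) (use assms in auto)
  have mon: "\<nu> / real CARD('n) * (norm ?e)\<^sup>2 \<le> ?g \<bullet> ?e"
    unfolding S_def by (rule dual_grad_restricted_strongly_monotone[OF assms(3) _ assms(5)]) (use assms in auto)
  have cs: "?g \<bullet> ?e \<le> norm ?g * norm ?e" by (rule norm_cauchy_schwarz)
  have "norm ?g * norm ?g \<le> norm ?g * (Lbar * norm ?e)"
    using co mult_left_mono[OF cs less_imp_le[OF assms(6)]] by (simp add: power2_eq_square mult_ac)
  then have "norm ?g \<le> Lbar * norm ?e"
    using assms(6) e by (cases "?g = 0") (auto simp: mult_le_cancel_left_pos)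
  then have "norm ?g * norm ?e \<le> Lbar * norm ?e * norm ?e"
    by (rule mult_right_mono) simp
  then have "\<nu> / real CARD('n) * (norm ?e)\<^sup>2 \<le> Lbar * (norm ?e)\<^sup>2"
    using mon cs by (simp only: power2_eq_square mult.assoc)
  then show ?thesis using e by (simp only: mult_le_cancel_right_pos zero_less_power)
qed

text \<open>\<open>D\<close> is built from local minimizers, so the dual estimate carries their
  existence as a premise; \<open>c3 < 1\<close> keeps the denominator in the error floor
  positive.\<close>

theorem theorem4:
  fixes A :: "real^'q^'p" and own :: "'q \<Rightarrow> 'n::finite" and b :: "real^'p"
    and W :: "real^'n^'n" and lam :: "nat \<Rightarrow> real"
    and x :: "nat \<Rightarrow> 'n \<Rightarrow> real^'p" and xbar_star :: "nat \<Rightarrow> real^'p"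
    and \<gamma> \<alpha> \<beta> \<theta> \<nu>f Lh Lbar \<nu>bar c1 c2 D :: real
  assumes "\<gamma> > 0"
    and "\<exists>y. A *v y = b"
    and "minimizers (dual_obj \<gamma> own A b) \<noteq> {}"
    and "\<nu>f > 0" and "restricted_strongly_convex (dual_obj \<gamma> own A b) \<nu>f"
    and "transpose W = W" and "doubly_stochastic W"
    and "eigenvalue_list W lam" and "lam 1 = 1" and "-1 \<le> lam CARD('n)"
    and "\<beta> = max \<bar>lam 2\<bar> \<bar>lam CARD('n)\<bar>" and "\<beta> < 1"
    and "Lh = (MAX i. \<gamma> * (spectral_norm (block own A i))\<^sup>2)"
    and "Lbar = \<gamma> / real CARD('n) * (\<Sum>i\<in>UNIV. (spectral_norm (block own A i))\<^sup>2)"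
    and "\<nu>bar = \<nu>f / real CARD('n)"
    and "0 \<le> \<theta>" and "\<theta> \<le> 1" and "c1 = \<theta> / Lbar" and "c2 = (1 - \<theta>) * \<nu>bar"
    and "D = D_const \<gamma> own A b Lh"
    and "\<And>i. x 0 i = 0"
    and "\<And>k i. x (Suc k) i =
           (\<Sum>j\<in>UNIV. W $ i $ j *\<^sub>R x k j) -
           \<alpha> *\<^sub>R (block own A i *v local_primal \<gamma> own A x k i - (1 / real CARD('n)) *\<^sub>R b)"
    and "\<And>k. xbar_star k = closest_point (minimizers (dual_obj \<gamma> own A b)) (average (x k))"
    and "\<alpha> > 0" and "\<alpha> < min ((1 + lam CARD('n)) / Lh) c1"
  shows
    "((\<forall>i. minimizers (local_obj \<gamma> own A b i) \<noteq> {}) \<longrightarrow>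
        (\<forall>\<delta>>0. c3 c2 \<alpha> \<delta> < 1 \<longrightarrow>
           (\<forall>i k. norm (x k i - xbar_star k)
                  \<le> c3 c2 \<alpha> \<delta> ^ k * norm (xbar_star 0) + error_floor Lh D c2 \<beta> \<alpha> \<delta>)) \<and>
        (\<theta> < 1 \<longrightarrow>
           delta_opt c2 \<alpha> > 0 \<and>
           c3 c2 \<alpha> (delta_opt c2 \<alpha>) = sqrt (1 - \<alpha> * c2 / 2) \<and>
           c3 c2 \<alpha> (delta_opt c2 \<alpha>) \<in> {0<..<1} \<and>
           (\<lambda>(a, \<beta>'). error_floor Lh D c2 \<beta>' a (delta_opt c2 a))
             \<in> O[principal ({0<..<c1} \<times> {0..<1})](\<lambda>(a, \<beta>'). a / (1 - \<beta>')))) \<and>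
     (\<exists>!ystar. primal_solution \<gamma> A b ystar) \<and>
     (\<forall>ystar k. primal_solution \<gamma> A b ystar \<longrightarrow>
        norm (stacked_primal \<gamma> own A x k - ystar)
          \<le> real CARD('n) * \<gamma> *
            (MAX i. spectral_norm (block own A i) * norm (x k i - xbar_star k)))"
proof -
  let ?f = "dual_obj \<gamma> own A b" and ?S = "minimizers (dual_obj \<gamma> own A b)" and ?n = "real CARD('n)"
  note \<gamma> = assms(1) and S_ne = assms(3) and rsc = assms(5)
  have \<gamma>0: "\<gamma> \<ge> 0" using \<gamma> by simp
  have step: "0 < \<alpha>" "\<alpha> < (1 + lam CARD('n)) / Lh" "\<alpha> < c1" using assms(24,25) by auto
  have Lh_ge: "\<gamma> * (spectral_norm (block own A i))\<^sup>2 \<le> Lh" for i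
    unfolding assms(13) by (rule Max_ge) auto
  have "0 \<le> Lh" using Lh_ge \<gamma>0 by (meson mult_nonneg_nonneg order_trans zero_le_power2)
  \<comment> \<open>Division by zero yields 0, so \<open>Lh = 0\<close> would leave no positive
    stepsize; \<open>Lbar\<close> is positive for the same reason, through
    \<open>c1\<close>.\<close>
  then have Lh: "0 < Lh" using step by (cases "Lh = 0") auto
  have "0 \<le> Lbar" unfolding assms(14) using \<gamma>0 by (simp add: sum_nonneg)
  then have Lbar: "0 < Lbar" using step assms(18) by (cases "Lbar = 0") auto
  have c1: "0 < c1" using step by simp
  have \<nu>bar: "0 < \<nu>bar" using assms(4,15) by simp
  have \<nu>L: "\<nu>bar \<le> Lbar"
    unfolding assms(15) using restricted_modulus_le[OF \<gamma> S_ne rsc] Lbar unfolding assms(14) by simp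
  have c2: "0 \<le> c2" using assms(17,19) \<nu>bar by simp
  \<comment> \<open>Both \<open>\<theta> * (1 - \<theta>)\<close> and \<open>\<nu>bar / Lbar\<close>
    are at most 1; the resulting \<open>\<alpha> * c2 < 1\<close> keeps the contraction factor
    nonnegative.\<close>
  have "c1 * c2 = \<theta> * (1 - \<theta>) * (\<nu>bar / Lbar)" by (simp add: assms(18,19))
  also have "\<dots> \<le> 1 * 1"
    using assms(16,17) \<nu>L \<nu>bar Lbar by (intro mult_mono mult_le_one) auto
  finally have c12: "c1 * c2 \<le> 1" by simp
  have \<alpha>c2: "\<alpha> * c2 < 1"
  proof (cases "c2 = 0")
    case False
    then have "\<alpha> * c2 < c1 * c2" using c2 step(3) by (intro mult_strict_right_mono) auto
    with c12 show ?thesis by simp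
  qed simp

  interpret dgd W lam \<beta> Lh \<alpha> "local_obj \<gamma> own A b" "local_grad \<gamma> own A b" "\<lambda>k. \<chi> i. x k i"
  proof
    show "local_obj \<gamma> own A b i v \<le> local_obj \<gamma> own A b i u + local_grad \<gamma> own A b i u \<bullet> (v - u) + Lh / 2 * (norm (v - u))\<^sup>2" for i u v
      by (rule local_obj_upper[OF \<gamma>0 Lh_ge])
    show "norm (local_grad \<gamma> own A b i u - local_grad \<gamma> own A b i v) \<le> Lh * norm (u - v)" for i u v
      using norm_local_grad_diff_le[OF \<gamma>0] mult_right_mono[OF Lh_ge norm_ge_zero] by (rule order_trans)
    show "\<alpha> * Lh \<le> 1 + lam CARD('n)"
      using step(2) Lh by (simp add: pos_less_divide_eq)
    show "(\<chi> i. x 0 i) = 0" using assms(21) by (simp add: vec_eq_iff)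
    show "(\<chi> i. x (Suc k) i) = mix W (\<chi> i. x k i) - \<alpha> *\<^sub>R (\<chi> i. local_grad \<gamma> own A b i ((\<chi> i. x k i) $ i))" for k
      by (simp add: vec_eq_iff assms(22) mix_def local_grad_def local_primal_def matrix_vector_mult_scaleR)
  qed (use assms step Lh in auto)

  have star: "xbar_star k = closest_point ?S (mean (\<chi> i. x k i))" for k
    by (simp add: assms(23) average_def mean_def)
  have star_0: "xbar_star 0 = closest_point ?S 0"
    by (simp add: star X_0 mean_def)
  have star_in: "xbar_star k \<in> ?S" for k
    unfolding star by (intro closest_point_in_set closed_minimizers_dual_obj \<gamma>0 S_ne)

  have dual: "(\<forall>i. minimizers (local_obj \<gamma> own A b i) \<noteq> {}) \<longrightarrow>
      (\<forall>\<delta>>0. c3 c2 \<alpha> \<delta> < 1 \<longrightarrow>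
         (\<forall>i k. norm (x k i - xbar_star k)
                \<le> c3 c2 \<alpha> \<delta> ^ k * norm (xbar_star 0) + error_floor Lh D c2 \<beta> \<alpha> \<delta>))"
  proof (intro impI allI)
    fix \<delta> :: real and i k
    assume loc: "\<forall>i. minimizers (local_obj \<gamma> own A b i) \<noteq> {}" and \<delta>: "0 < \<delta>" and lt: "c3 c2 \<alpha> \<delta> < 1"
    define q where "q = (1 + \<alpha> * \<delta>) * (1 - \<alpha> * c2)"
    have c3: "c3 c2 \<alpha> \<delta> = sqrt q" by (simp add: c3_def q_def algebra_simps power2_eq_square)
    have q: "0 \<le> q" "q < 1" using step(1) \<delta> \<alpha>c2 lt c3 by (simp_all add: q_def)
    have D: "norm (grads (\<chi> i. x k i)) \<le> D" for k
      unfolding assms(20) D_const_def using loc by (intro norm_grads_le arg_min_le_if_minimizers) auto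
    \<comment> \<open>The average, with weights \<open>\<theta>\<close> and \<open>1 - \<theta>\<close>, of cocoercivity and restricted strong monotonicity.\<close>
    have coer: "c1 * (norm (mean (\<chi> i. local_grad \<gamma> own A b i z)))\<^sup>2 + c2 * (norm (z - closest_point ?S z))\<^sup>2
        \<le> mean (\<chi> i. local_grad \<gamma> own A b i z) \<bullet> (z - closest_point ?S z)" for z
    proof -
      let ?g = "mean (\<chi> i. local_grad \<gamma> own A b i z)" and ?e = "z - closest_point ?S z"
      have "(norm ?g)\<^sup>2 \<le> Lbar * (?g \<bullet> ?e)"
        unfolding assms(14) by (rule dual_grad_restricted_cocoercive[OF \<gamma> S_ne rsc])
      then have "\<theta> * ((norm ?g)\<^sup>2 / Lbar) \<le> \<theta> * (?g \<bullet> ?e)"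
        using assms(16) Lbar by (intro mult_left_mono) (simp_all add: pos_divide_le_eq mult.commute)
      moreover have "(1 - \<theta>) * (\<nu>bar * (norm ?e)\<^sup>2) \<le> (1 - \<theta>) * (?g \<bullet> ?e)"
        unfolding assms(15) using assms(17)
        by (intro mult_left_mono dual_grad_restricted_strongly_monotone[OF \<gamma> S_ne rsc]) simp
      ultimately show ?thesis by (simp add: assms(18,19) algebra_simps)
    qed
    have "norm ((\<chi> i. x k i) $ i - closest_point ?S (mean (\<chi> i. x k i)))
      \<le> sqrt q ^ k * norm (closest_point ?S 0)
        + (sqrt (\<alpha> * (\<alpha> + inverse \<delta>) * (Lh * (\<alpha> * D / (1 - \<beta>)))\<^sup>2) / sqrt (1 - q) + \<alpha> * D / (1 - \<beta>))"
      by (rule distance_to_minimizers[OF D closed_minimizers_dual_obj[OF \<gamma>0] S_ne coer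
            less_imp_le[OF step(3)] c2 \<delta> q_def q])
    moreover have "\<alpha> * (\<alpha> + inverse \<delta>) * (Lh * (\<alpha> * D / (1 - \<beta>)))\<^sup>2
        = \<alpha> ^ 3 * (\<alpha> + inverse \<delta>) * (Lh\<^sup>2 * D\<^sup>2 / (1 - \<beta>)\<^sup>2)"
      by (simp add: power_mult_distrib power_divide power2_eq_square power3_eq_cube)
    ultimately show "norm (x k i - xbar_star k)
        \<le> c3 c2 \<alpha> \<delta> ^ k * norm (xbar_star 0) + error_floor Lh D c2 \<beta> \<alpha> \<delta>"
      using q(1) by (simp add: error_floor_def c4_def c3 star star_0[unfolded star])
  qed

  have optimal: "\<theta> < 1 \<longrightarrow>
      delta_opt c2 \<alpha> > 0 \<and>
      c3 c2 \<alpha> (delta_opt c2 \<alpha>) = sqrt (1 - \<alpha> * c2 / 2) \<and>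
      c3 c2 \<alpha> (delta_opt c2 \<alpha>) \<in> {0<..<1} \<and>
      (\<lambda>(a, \<beta>'). error_floor Lh D c2 \<beta>' a (delta_opt c2 a))
        \<in> O[principal ({0<..<c1} \<times> {0..<1})](\<lambda>(a, \<beta>'). a / (1 - \<beta>'))"
  proof
    assume "\<theta> < 1"
    then have c2: "0 < c2" using \<nu>bar assms(19) by simp
    then have "0 < \<alpha> * c2" using step(1) by simp
    moreover have "0 < delta_opt c2 \<alpha>" using c2 \<alpha>c2 by (simp add: delta_opt_def)
    ultimately show "delta_opt c2 \<alpha> > 0 \<and>
      c3 c2 \<alpha> (delta_opt c2 \<alpha>) = sqrt (1 - \<alpha> * c2 / 2) \<and>
      c3 c2 \<alpha> (delta_opt c2 \<alpha>) \<in> {0<..<1} \<and>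
      (\<lambda>(a, \<beta>'). error_floor Lh D c2 \<beta>' a (delta_opt c2 a))
        \<in> O[principal ({0<..<c1} \<times> {0..<1})](\<lambda>(a, \<beta>'). a / (1 - \<beta>'))"
      using \<alpha>c2 error_floor_bigo[OF c1 c2 c12] by (simp add: c3_delta_opt)
  qed

  \<comment> \<open>The characterization holds with every \<open>xbar_star k\<close>: index 0
    settles uniqueness, and each iterate below uses its own projection.\<close>
  note sol_iff = primal_solution_iff[OF \<gamma> star_in]
  have unique: "\<exists>!ystar. primal_solution \<gamma> A b ystar"
    unfolding sol_iff[of _ 0] by blast
  have primal: "\<forall>ystar k. primal_solution \<gamma> A b ystar \<longrightarrow>
      norm (stacked_primal \<gamma> own A x k - ystar)
        \<le> ?n * \<gamma> * (MAX i. spectral_norm (block own A i) * norm (x k i - xbar_star k))"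
  proof (intro allI impI)
    fix ystar k
    assume "primal_solution \<gamma> A b ystar"
    then have "ystar = \<gamma> *\<^sub>R shrink (transpose A *v xbar_star k)"
      by (rule sol_iff[THEN iffD1])
    then show "norm (stacked_primal \<gamma> own A x k - ystar)
        \<le> ?n * \<gamma> * (MAX i. spectral_norm (block own A i) * norm (x k i - xbar_star k))"
      by (simp only: norm_stacked_primal_diff_le[OF \<gamma>])
  qed

  show ?thesis using dual optimal unique primal by iprover
qed

end
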